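(* Consider the 1-factor copula model with known linking copulas: $V\sim U(0,1)$ is a latent variable, and given $V=v$ the observed $U(0,1)$ variables $U_1,U_2,\dots$ are independent with $U_j$ having density $c_{jV}(\cdot,v)$, where $c_{jV}$ is the density of the bivariate copula linking $U_j$ and $V$; so $(U_1,\dots,U_D)$ has copula density $\int_0^1\prod_{j=1}^Dc_{jV}(u_j,v)\,dv$. Suppose there is a realized infinite sequence $u_1,u_2,\dots$ with latent variable value $v^0$ (independent of the dimension $D$) from this model. For the truncation to the first $D$ variables let $\boldsymbol{u}_D=(u_1,\dots,u_D)^T$, and define the averaged negative log-likelihood in the parameter $v$ as $$\bar L_D(v)=-D^{-1}\sum_{j=1}^D\log c_{jV}(u_j,v).$$ Assume $\lim_{D\to\infty}\bar L_D$ asymptotically has a global minimum and is strictly locally convex at the minimum. Also assume that the linking copulas have monotonic dependence and that the likelihood function satisfies the usual regularity conditions for maximum likelihood (listed in the context). Let the proxy be $$\widetilde v_D=\mathrm{E}(V\mid U_1=u_1,\dots,U_D=u_D)=\frac{\int_0^1 v\prod_{j=1}^Dc_{jV}(u_j,v)\,dv}{\int_0^1\prod_{j=1}^Dc_{jV}(u_j,v)\,dv}.$$ Then $\widetilde v_D-v^0=O_p(D^{-1/2})$ as $D\to\infty$.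
   Context: The symbol $O_p$ refers to the randomness of $U_1,U_2,\dots$ given $V=v^0$ (independent, non-identically distributed with $U_j\sim c_{jV}(\cdot,v^0)$). Standing assumptions: (a) the bivariate linking copulas have monotonic dependence, i.e. each observed variable is monotonically related to the latent variable; (b) for any fixed dimension, the log-likelihood function, with the latent variable considered as a parameter to be estimated, satisfies standard regularity conditions for maximum likelihood from independent, non-identically distributed observations (such as those of Bradley and Gart, 1962), for example continuity of derivatives up to third order of the log-densities of the bivariate linking copulas with respect to $v$. In their usual form such conditions also require: first and second $v$-derivatives of the densities dominated by integrable functions; third $v$-derivatives of the log-densities dominated by functions with uniformly bounded expectations; and the averaged Fisher information having a finite positive limit.
   Formalization: The global minimum of the limit is required to be unique and its value not approached elsewhere, in particular not near v=0 or v=1, and strict local convexity means a positive second derivative there; with only some global minimum the posterior can keep mass away from v^0. *)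

theory Defs
  imports "HOL-Probability.Probability"
begin

text \<open>
  Only the values on the open unit square matter. Asking for Borel measurability on the whole plane
  is no restriction (extend by 0); it makes all statistics below measurable everywhere.
  The last two conjuncts say that both margins are uniform on the unit interval.
\<close>

definition copula_density :: "(real \<Rightarrow> real \<Rightarrow> real) \<Rightarrow> bool" where
  "copula_density c \<longleftrightarrow>
     (\<lambda>(u, v). c u v) \<in> borel_measurable (borel \<Otimes>\<^sub>M borel) \<and>
     (\<forall>u\<in>{0<..<1}. \<forall>v\<in>{0<..<1}. 0 \<le> c u v) \<and>
     (AE v in lborel. v \<in> {0<..<1} \<longrightarrow> (\<integral>\<^sup>+u\<in>{0<..<1}. ennreal (c u v) \<partial>lborel) = 1) \<and>
     (AE u in lborel. u \<in> {0<..<1} \<longrightarrow> (\<integral>\<^sup>+v\<in>{0<..<1}. ennreal (c u v) \<partial>lborel) = 1)"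

definition cond_cdf :: "(real \<Rightarrow> real \<Rightarrow> real) \<Rightarrow> real \<Rightarrow> real \<Rightarrow> real" where
  "cond_cdf c u v = (LINT t:{0<..u}|lborel. c t v)"

text \<open>Stochastically increasing (first disjunct) or stochastically decreasing in the latent variable.\<close>

definition monotonic_dependence :: "(real \<Rightarrow> real \<Rightarrow> real) \<Rightarrow> bool" where
  "monotonic_dependence c \<longleftrightarrow>
     (\<forall>u\<in>{0<..<1}. antimono_on {0<..<1} (cond_cdf c u)) \<or>
     (\<forall>u\<in>{0<..<1}. mono_on {0<..<1} (cond_cdf c u))"

text \<open>
  Variables are numbered from 1, so \<^term>\<open>c j\<close> and \<^term>\<open>u j\<close> are only used for \<^term>\<open>1 \<le> (j::nat)\<close>.
\<close>

definition factor_copula_density ::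
    "(nat \<Rightarrow> real \<Rightarrow> real \<Rightarrow> real) \<Rightarrow> nat \<Rightarrow> (nat \<Rightarrow> real) \<Rightarrow> real" where
  "factor_copula_density c D u = (LINT v:{0<..<1}|lborel. (\<Prod>j=1..D. c j (u j) v))"

text \<open>
  The mean of the conditional distribution of the latent variable given the first \<^term>\<open>D\<close>
  observations.
\<close>

definition proxy :: "(nat \<Rightarrow> real \<Rightarrow> real \<Rightarrow> real) \<Rightarrow> nat \<Rightarrow> (nat \<Rightarrow> real) \<Rightarrow> real" where
  "proxy c D u =
     (LINT v:{0<..<1}|lborel. v * (\<Prod>j=1..D. c j (u j) v)) / factor_copula_density c D u"

definition avg_nll :: "(nat \<Rightarrow> real \<Rightarrow> real \<Rightarrow> real) \<Rightarrow> nat \<Rightarrow> (nat \<Rightarrow> real) \<Rightarrow> real \<Rightarrow> real" where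
  "avg_nll c D u v = - (\<Sum>j=1..D. ln (c j (u j) v)) / real D"

text \<open>
  The law of \<^term>\<open>U 1\<close>, \<^term>\<open>U 2\<close>, and so on given that the latent variable has the value \<^term>\<open>v0\<close>.
\<close>

definition observed_given_latent ::
    "'a measure \<Rightarrow> (nat \<Rightarrow> real \<Rightarrow> real \<Rightarrow> real) \<Rightarrow> real \<Rightarrow> (nat \<Rightarrow> 'a \<Rightarrow> real) \<Rightarrow> bool" where
  "observed_given_latent M c v0 U \<longleftrightarrow>
     prob_space M \<and>
     prob_space.indep_vars M (\<lambda>_. borel) U {1..} \<and>
     (\<forall>j\<ge>1. distributed M lborel (U j) (\<lambda>u. ennreal (c j u v0) * indicator {0<..<1} u))"

definition score :: "(real \<Rightarrow> real \<Rightarrow> real) \<Rightarrow> real \<Rightarrow> real \<Rightarrow> real" where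
  "score c u v = deriv (\<lambda>v. ln (c u v)) v"

definition fisher_info :: "(real \<Rightarrow> real \<Rightarrow> real) \<Rightarrow> real \<Rightarrow> real" where
  "fisher_info c v = (LINT u:{0<..<1}|lborel. (score c u v)\<^sup>2 * c u v)"

text \<open>
  Conditions of Bradley and Gart for independent, non-identically distributed observations; the
  parameter space is the open unit interval and the true parameter is \<^term>\<open>v0\<close>. Expectations and
  Fisher information are needed at \<^term>\<open>v0\<close> only, dominations hold on the parameter space.
\<close>

definition ml_regular :: "(nat \<Rightarrow> real \<Rightarrow> real \<Rightarrow> real) \<Rightarrow> real \<Rightarrow> bool" where
  "ml_regular c v0 \<longleftrightarrow>
     (\<forall>j\<ge>1. \<forall>u\<in>{0<..<1}.
        (\<forall>v\<in>{0<..<1}. 0 < c j u v) \<and>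
        (\<forall>k<3. (deriv ^^ k) (\<lambda>v. ln (c j u v)) differentiable_on {0<..<1}) \<and>
        continuous_on {0<..<1} ((deriv ^^ 3) (\<lambda>v. ln (c j u v)))) \<and>
     (\<forall>j\<ge>1. \<exists>F. set_integrable lborel {0<..<1} F \<and>
        (\<forall>u\<in>{0<..<1}. \<forall>v\<in>{0<..<1}.
           \<bar>deriv (c j u) v\<bar> \<le> F u \<and> \<bar>(deriv ^^ 2) (c j u) v\<bar> \<le> F u)) \<and>
     (\<exists>B. \<forall>j\<ge>1. \<exists>H.
        (\<forall>u\<in>{0<..<1}. \<forall>v\<in>{0<..<1}. \<bar>(deriv ^^ 3) (\<lambda>v. ln (c j u v)) v\<bar> \<le> H u) \<and>
        set_integrable lborel {0<..<1} (\<lambda>u. H u * c j u v0) \<and>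
        (LINT u:{0<..<1}|lborel. H u * c j u v0) \<le> B) \<and>
     (\<forall>j\<ge>1. set_integrable lborel {0<..<1} (\<lambda>u. (score (c j) u v0)\<^sup>2 * c j u v0)) \<and>
     (\<exists>I>0. (\<lambda>D. (\<Sum>j=1..D. fisher_info (c j) v0) / real D) \<longlonglongrightarrow> I)"

definition tendsto_in_prob :: "'a measure \<Rightarrow> (nat \<Rightarrow> 'a \<Rightarrow> real) \<Rightarrow> real \<Rightarrow> bool" where
  "tendsto_in_prob M X l \<longleftrightarrow>
     (\<forall>e>0. (\<lambda>n. measure M {\<omega> \<in> space M. e < \<bar>X n \<omega> - l\<bar>}) \<longlonglongrightarrow> 0)"

text \<open>Measurability is demanded because \<^const>\<open>measure\<close> is 0 on non-measurable sets.\<close>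

definition bigo_in_prob :: "'a measure \<Rightarrow> (nat \<Rightarrow> 'a \<Rightarrow> real) \<Rightarrow> (nat \<Rightarrow> real) \<Rightarrow> bool" where
  "bigo_in_prob M X a \<longleftrightarrow>
     (\<forall>n. X n \<in> borel_measurable M) \<and>
     (\<forall>e>0. \<exists>K>0. \<forall>\<^sub>F n in sequentially.
        measure M {\<omega> \<in> space M. K * \<bar>a n\<bar> < \<bar>X n \<omega>\<bar>} < e)"

text \<open>
  Strictness of the minimum is uniform away from \<^term>\<open>m\<close>: the minimal value is not approached at
  the end points of the open interval either. For a function that extends continuously to the
  closed unit interval this just says that \<^term>\<open>m\<close> is the unique minimum of the extension.
\<close>

definition global_min_at :: "(real \<Rightarrow> real) \<Rightarrow> real \<Rightarrow> bool" where
  "global_min_at L m \<longleftrightarrow>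
     m \<in> {0<..<1} \<and>
     (\<forall>d>0. \<exists>h>0. \<forall>v\<in>{0<..<1}. d \<le> \<bar>v - m\<bar> \<longrightarrow> L m + h \<le> L v)"

definition strictly_locally_convex_at :: "(real \<Rightarrow> real) \<Rightarrow> real \<Rightarrow> bool" where
  "strictly_locally_convex_at L m \<longleftrightarrow>
     (\<forall>\<^sub>F v in nhds m. L differentiable at v) \<and>
     (\<exists>k>0. (deriv L has_real_derivative k) (at m))"

end

theory Submission
  imports Defs "HOL-Real_Asymp.Real_Asymp"
begin

text \<open>
  Write \<open>L\<^sub>D\<close> for the averaged negative log-likelihood. Its third derivative is bounded on the whole
  unit interval by an average with bounded expectation, so by Markov's inequality it is bounded with
  high probability; hence the convergence of \<open>L\<^sub>D\<close> at finitely many points controls \<open>L\<^sub>D\<close>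
  uniformly and also its curvature at the minimum of the limit. That minimum is \<open>v0\<close>, because the
  likelihood ratio of any \<open>v\<close> against \<open>v0\<close> has mean 1. The score at \<open>v0\<close> is a sum of centred independent variables,
  so by Chebyshev's inequality \<open>L\<^sub>D\<close> has slope of order at most \<open>D\<close> to the power \<open>-1/2\<close> at \<open>v0\<close>.
  Together, \<open>L\<^sub>D\<close> lies between two parabolas with their vertices within that order of \<open>v0\<close>, the
  posterior weight \<open>exp (- D * L\<^sub>D)\<close> lies between two Gaussian weights of that width, and the first absolute
  moment of the posterior around \<open>v0\<close> has the same order.
\<close>

section \<open>Taylor bounds and quadratic growth of a function with bounded third
  derivative\<close>

text \<open>Taylor's formula with Lagrange remainder. The sequence \<open>g\<close> holds the
  function and its successive derivatives, the form in which averages of iterated derivatives of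
  log-densities are inserted later.\<close>

lemma cubic_taylor_bound:
  fixes g :: "nat \<Rightarrow> real \<Rightarrow> real"
  assumes deriv: "\<And>m v. m < 3 \<Longrightarrow> v \<in> S \<Longrightarrow> (g m has_real_derivative g (Suc m) v) (at v)"
    and third: "\<And>v. v \<in> S \<Longrightarrow> \<bar>g 3 v\<bar> \<le> B"
    and S: "is_interval S" "x \<in> S" "y \<in> S"
  shows "\<bar>g 0 y - (g 0 x + g 1 x * (y - x) + g 2 x * (y - x)\<^sup>2 / 2)\<bar> \<le> B * \<bar>y - x\<bar> ^ 3 / 6"
proof (cases "y = x")
  case False
  have sub: "t \<in> S" if "min x y \<le> t" "t \<le> max x y" for t
    using mem_is_interval_1_I[OF S(1), of "min x y" "max x y" t] that S(2,3)
    by (simp add: min_def max_def split: if_splits)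
  have "\<exists>t. (if y < x then y < t \<and> t < x else x < t \<and> t < y) \<and>
      g 0 y = (\<Sum>m<3. (g m x / fact m) * (y - x) ^ m) + (g 3 t / fact 3) * (y - x) ^ 3"
  proof (rule Taylor[where a = "min x y" and b = "max x y"])
    show "\<forall>m t. m < 3 \<and> min x y \<le> t \<and> t \<le> max x y \<longrightarrow> (g m has_real_derivative g (Suc m) t) (at t)"
      using deriv sub by blast
  qed (use False in auto)
  then obtain t where t: "if y < x then y < t \<and> t < x else x < t \<and> t < y"
    and eq: "g 0 y = (\<Sum>m<3. (g m x / fact m) * (y - x) ^ m) + (g 3 t / fact 3) * (y - x) ^ 3"
    by blast
  have "t \<in> S" using t by (intro sub) (auto split: if_splits)
  have "g 0 y - (g 0 x + g 1 x * (y - x) + g 2 x * (y - x)\<^sup>2 / 2) = g 3 t * (y - x) ^ 3 / 6"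
  proof -
    have *: "{..<3} = {0, 1, 2::nat}" by auto
    have "fact 2 = (2::real)" "fact 3 = (6::real)" by (simp_all add: fact_numeral)
    then show ?thesis by (simp add: eq *)
  qed
  then have "\<bar>g 0 y - (g 0 x + g 1 x * (y - x) + g 2 x * (y - x)\<^sup>2 / 2)\<bar> = \<bar>g 3 t * (y - x) ^ 3 / 6\<bar>"
    by (rule arg_cong)
  then show ?thesis
    unfolding abs_divide abs_mult power_abs
    using mult_right_mono[OF third[OF \<open>t \<in> S\<close>], of "\<bar>y - x\<bar> ^ 3"] by simp
qed simp

text \<open>A second derivative is known at \<open>m\<close> only, so the mean value theorem is
  applied to the second difference as a function of its step; the derivative of that function is
  controlled by the linear approximation of \<open>deriv L\<close> at \<open>m\<close>. The second
  difference reads the curvature off three values of \<open>L\<close>, without its slope.\<close>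

lemma second_difference_approx:
  fixes L :: "real \<Rightarrow> real"
  assumes diff: "\<forall>\<^sub>F v in nhds m. L differentiable at v"
    and L2: "(deriv L has_real_derivative k) (at m)"
    and "0 < e"
  shows "\<exists>h0>0. \<forall>h. 0 < h \<and> h < h0 \<longrightarrow> \<bar>L (m + h) + L (m - h) - 2 * L m - k * h\<^sup>2\<bar> \<le> e * h\<^sup>2"
proof -
  obtain d1 where d1: "d1 > 0" "\<And>v. \<bar>v - m\<bar> < d1 \<Longrightarrow> L differentiable at v"
    using diff unfolding eventually_nhds_metric dist_real_def by blast
  have "((\<lambda>t. (deriv L (m + t) - deriv L m) / t) \<longlongrightarrow> k) (at 0)"
    using L2 by (simp add: DERIV_def)
  then obtain d2 where d2: "d2 > 0"
    "\<And>t. t \<noteq> 0 \<Longrightarrow> \<bar>t\<bar> < d2 \<Longrightarrow> \<bar>(deriv L (m + t) - deriv L m) / t - k\<bar> < e / 2"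
    using \<open>0 < e\<close> unfolding tendsto_iff eventually_at dist_real_def diff_0_right
    by (metis UNIV_I half_gt_zero)
  have lin: "\<bar>deriv L (m + t) - deriv L m - k * t\<bar> \<le> e / 2 * \<bar>t\<bar>" if "t \<noteq> 0" "\<bar>t\<bar> < d2" for t
  proof -
    have "\<bar>deriv L (m + t) - deriv L m - k * t\<bar> = \<bar>(deriv L (m + t) - deriv L m) / t - k\<bar> * \<bar>t\<bar>"
      using that by (simp flip: abs_mult add: field_simps)
    then show ?thesis
      using mult_right_mono[OF less_imp_le[OF d2(2)[OF that]], of "\<bar>t\<bar>"] by simp
  qed
  show ?thesis
  proof (intro exI[of _ "min d1 d2"] conjI allI impI)
    fix h assume h: "0 < h \<and> h < min d1 d2"
    define g where "g t = L (m + t) + L (m - t) - 2 * L m - k * t\<^sup>2" for t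
    have L: "(L has_real_derivative deriv L v) (at v)" if "\<bar>v - m\<bar> < d1" for v
      using d1(2)[OF that] by (simp add: DERIV_deriv_iff_real_differentiable)
    have "(g has_real_derivative (deriv L (m + t) - deriv L (m - t) - 2 * k * t)) (at t)"
      if "0 \<le> t" "t \<le> h" for t
    proof -
      have "((\<lambda>t. L (m + t)) has_real_derivative deriv L (m + t) * 1) (at t)"
        by (rule DERIV_chain2[where f = L]) (use that h in \<open>auto intro!: L derivative_eq_intros\<close>)
      moreover have "((\<lambda>t. L (m - t)) has_real_derivative deriv L (m - t) * - 1) (at t)"
        by (rule DERIV_chain2[where f = L]) (use that h in \<open>auto intro!: L derivative_eq_intros\<close>)
      ultimately show ?thesis
        unfolding g_def by (auto intro!: derivative_eq_intros)
    qed
    then obtain t where t: "0 < t" "t < h"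
      "g h - g 0 = (h - 0) * (deriv L (m + t) - deriv L (m - t) - 2 * k * t)"
      using MVT2[of 0 h g "\<lambda>t. deriv L (m + t) - deriv L (m - t) - 2 * k * t"] h by auto
    have "\<bar>deriv L (m + t) - deriv L (m - t) - 2 * k * t\<bar> \<le> e * t"
    proof -
      have "deriv L (m + t) - deriv L (m - t) - 2 * k * t =
          (deriv L (m + t) - deriv L m - k * t) - (deriv L (m + - t) - deriv L m - k * - t)" by simp
      also have "\<bar>\<dots>\<bar> \<le> e / 2 * \<bar>t\<bar> + e / 2 * \<bar>- t\<bar>"
        by (intro order_trans[OF abs_triangle_ineq4] add_mono lin) (use t h in auto)
      finally show ?thesis using t by simp
    qed
    then have "\<bar>g h\<bar> \<le> h * (e * t)"
      using t h by (simp add: g_def abs_mult)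
    also have "\<dots> \<le> e * h\<^sup>2" using t h \<open>0 < e\<close>
      by (simp add: power2_eq_square mult.assoc mult.left_commute mult_left_mono)
    finally show "\<bar>L (m + h) + L (m - h) - 2 * L m - k * h\<^sup>2\<bar> \<le> e * h\<^sup>2" by (simp add: g_def)
  qed (use d1 d2 in auto)
qed

text \<open>
  A second difference at \<open>v0\<close> determines the curvature there, which gives the bounds near \<open>v0\<close>; away
  from \<open>v0\<close> the function is Lipschitz with a known constant, so a fine grid suffices.
\<close>

lemma quadratic_growth_from_finitely_many_points:
  fixes L :: "real \<Rightarrow> real"
  assumes min: "global_min_at L v0" and conv: "strictly_locally_convex_at L v0"
    and "0 < B" "0 \<le> K"
  shows "\<exists>P e a A. finite P \<and> P \<subseteq> {0<..<1} \<and> 0 < e \<and> 0 < a \<and> 0 < A \<and>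
    (\<forall>g r. (\<forall>m<3. \<forall>v\<in>{0<..<1}. (g m has_real_derivative g (Suc m) v) (at v)) \<longrightarrow>
        (\<forall>v\<in>{0<..<1}. \<bar>g 3 v\<bar> \<le> B) \<longrightarrow> (\<forall>p\<in>P. \<bar>g 0 p - L p\<bar> \<le> e) \<longrightarrow>
        \<bar>g 1 v0\<bar> \<le> r \<longrightarrow> r \<le> K \<longrightarrow>
        (\<forall>v\<in>{0<..<1}. - r * \<bar>v - v0\<bar> + a * (v - v0)\<^sup>2 \<le> g 0 v - g 0 v0 \<and>
            g 0 v - g 0 v0 \<le> r * \<bar>v - v0\<bar> + A * (v - v0)\<^sup>2))"
proof -
  have v0: "0 < v0" "v0 < 1" using min by (auto simp: global_min_at_def)
  obtain k where k: "0 < k" "(deriv L has_real_derivative k) (at v0)"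
    using conv by (auto simp: strictly_locally_convex_at_def)
  obtain h0 where h0: "0 < h0"
    "\<And>h. 0 < h \<Longrightarrow> h < h0 \<Longrightarrow> \<bar>L (v0 + h) + L (v0 - h) - 2 * L v0 - k * h\<^sup>2\<bar> \<le> k / 8 * h\<^sup>2"
    using second_difference_approx[of L v0 k "k / 8"] conv k
    by (auto simp: strictly_locally_convex_at_def)
  \<comment> \<open>The first entry puts \<open>h\<close> below \<open>h0\<close>, the next two keep
    \<open>v0 + h\<close> and \<open>v0 - h\<close> in the unit interval, the last makes the Taylor
    remainder of the second difference at most \<open>k / 8 * h\<^sup>2\<close>.\<close>
  define h where "h = Min {h0 / 2, v0 / 2, (1 - v0) / 2, 3 * k / (8 * B)}"
  have h: "0 < h" "h < h0" "h < v0" "h < 1 - v0" "h \<le> 3 * k / (8 * B)"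
    using h0 v0 k \<open>0 < B\<close> by (auto simp: h_def min_def)
  have hB: "B * h / 3 \<le> k / 8" using h(5) \<open>0 < B\<close> by (simp add: field_simps)
  \<comment> \<open>Within \<open>d\<close> of \<open>v0\<close> the cubic remainder is dominated by
    the quadratic term.\<close>
  define d where "d = k / (2 * B)"
  have d: "0 < d" using k \<open>0 < B\<close> by (simp add: d_def)
  \<comment> \<open>The gap is taken from distance \<open>d / 2\<close> on, because a point further
    than \<open>d\<close> from \<open>v0\<close> will be replaced by a grid point up to
    \<open>d / 2\<close> away from it.\<close>
  obtain s where s: "0 < s" "\<And>v. v \<in> {0<..<1} \<Longrightarrow> d / 2 \<le> \<bar>v - v0\<bar> \<Longrightarrow> L v0 + s \<le> L v"
    using min d unfolding global_min_at_def by (meson half_gt_zero)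
  \<comment> \<open>A Lipschitz constant of \<open>g 0\<close>: its slope at \<open>v0\<close> is at
    most \<open>K\<close>, its curvature there at most \<open>2 * k\<close>, its third derivative at
    most \<open>B\<close>, and all distances are below 1.\<close>
  define \<Lambda> where "\<Lambda> = K + 2 * k + B"
  have \<Lambda>: "0 < \<Lambda>" using k assms by (simp add: \<Lambda>_def)
  obtain N :: nat where N: "max 2 (max (2 / d) (4 * \<Lambda> / s)) < N" using reals_Archimedean2 by blast
  then have N': "2 < real N" "2 / d < N" "4 * \<Lambda> / s < N" by auto
  have N0: "real N > 0" using N' by linarith
  have N1: "1 / N \<le> d / 2" "\<Lambda> / N \<le> s / 4"
    using N' N0 d s by (auto simp: field_simps)
  define P where "P = insert v0 (insert (v0 + h) (insert (v0 - h) ((\<lambda>i. real i / N) ` {1..<N})))"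
  \<comment> \<open>The first bound limits the error of the second difference, in which deviations
    from \<open>L\<close> have total weight 4. The second leaves half of the gap \<open>s\<close>
    after a Lipschitz loss of \<open>s / 4\<close> and two deviations of
    \<open>s / 8\<close>.\<close>
  define e where "e = min (k * h\<^sup>2 / 32) (s / 8)"
  have e: "0 < e" "e \<le> k * h\<^sup>2 / 32" "e \<le> s / 8" using k h s by (auto simp: e_def)
  \<comment> \<open>\<open>k / 8\<close> serves near \<open>v0\<close>, and \<open>s / 2\<close>
    away from it, since squared distances are at most 1.\<close>
  define a where "a = min (k / 8) (s / 2)"
  define A where "A = k + B"
  show ?thesis
  proof (rule exI[of _ P], rule exI[of _ e], rule exI[of _ a], rule exI[of _ A], intro conjI allI impI ballI)
    show "finite P" "P \<subseteq> {0<..<1}" "0 < e" "0 < a" "0 < A"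
      using v0 h e k s \<open>0 < B\<close> by (auto simp: P_def a_def A_def)
  next
    fix g :: "nat \<Rightarrow> real \<Rightarrow> real" and r v :: real
    assume D: "\<forall>m<3. \<forall>v\<in>{0<..<1}. (g m has_real_derivative g (Suc m) v) (at v)"
      and g3: "\<forall>v\<in>{0<..<1}. \<bar>g 3 v\<bar> \<le> B" and gP: "\<forall>p\<in>P. \<bar>g 0 p - L p\<bar> \<le> e"
      and r: "\<bar>g 1 v0\<bar> \<le> r" "r \<le> K" and v: "v \<in> {0<..<1}"
    have taylor: "\<bar>g 0 y - (g 0 x + g 1 x * (y - x) + g 2 x * (y - x)\<^sup>2 / 2)\<bar> \<le> B * \<bar>y - x\<bar> ^ 3 / 6"
      if "x \<in> {0<..<1}" "y \<in> {0<..<1}" for x y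
      by (rule cubic_taylor_bound[where S = "{0<..<1}"]) (use D g3 that in \<open>auto simp: is_interval_1\<close>)
    have P3: "\<bar>g 0 v0 - L v0\<bar> \<le> e" "\<bar>g 0 (v0 + h) - L (v0 + h)\<bar> \<le> e" "\<bar>g 0 (v0 - h) - L (v0 - h)\<bar> \<le> e"
      using gP by (auto simp: P_def)
    have "\<bar>g 0 (v0 + h) + g 0 (v0 - h) - 2 * g 0 v0 - g 2 v0 * h\<^sup>2\<bar> \<le> B * h ^ 3 / 3"
    proof -
      have "\<bar>g 0 (v0 + h) - (g 0 v0 + g 1 v0 * h + g 2 v0 * h\<^sup>2 / 2)\<bar> \<le> B * h ^ 3 / 6"
        using taylor[of v0 "v0 + h"] h v0 by simp
      moreover have "\<bar>g 0 (v0 - h) - (g 0 v0 - g 1 v0 * h + g 2 v0 * h\<^sup>2 / 2)\<bar> \<le> B * h ^ 3 / 6"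
        using taylor[of v0 "v0 - h"] h v0 by simp
      ultimately show ?thesis by argo
    qed
    \<comment> \<open>The curvature of \<open>g 0\<close> against that of \<open>L\<close>: the
      Taylor remainder, the deviations at the three points and the second-difference error of
      \<open>L\<close> contribute at most \<open>k / 8 * h\<^sup>2\<close> each.\<close>
    then have "\<bar>g 2 v0 * h\<^sup>2 - k * h\<^sup>2\<bar> \<le> B * h ^ 3 / 3 + 4 * e + k / 8 * h\<^sup>2"
      using h0(2)[OF h(1,2)] P3 by linarith
    also have "\<dots> \<le> 3 * k / 8 * h\<^sup>2"
    proof -
      have "B * h ^ 3 / 3 \<le> k / 8 * h\<^sup>2"
        using mult_right_mono[OF hB, of "h\<^sup>2"] by (simp add: power2_eq_square power3_eq_cube mult.assoc)
      moreover have "4 * e \<le> k / 8 * h\<^sup>2" using e by simp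
      ultimately show ?thesis by simp
    qed
    finally have "\<bar>g 2 v0 - k\<bar> * h\<^sup>2 \<le> 3 * k / 8 * h\<^sup>2"
      by (simp add: abs_mult flip: left_diff_distrib)
    then have "\<bar>g 2 v0 - k\<bar> \<le> 3 * k / 8" using h(1) by simp
    then have g2: "5 * k / 8 \<le> g 2 v0" "g 2 v0 \<le> 2 * k" using k by linarith+
    have "v0 \<in> {0<..<1}" using v0 by simp
    note T = taylor[OF this v]
    have upper: "g 0 v - g 0 v0 \<le> g 1 v0 * (v - v0) + g 2 v0 * (v - v0)\<^sup>2 / 2 + B * \<bar>v - v0\<bar> ^ 3 / 6"
      using abs_le_D1[OF T] by argo
    have lower: "g 1 v0 * (v - v0) + g 2 v0 * (v - v0)\<^sup>2 / 2 - B * \<bar>v - v0\<bar> ^ 3 / 6 \<le> g 0 v - g 0 v0"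
      using abs_le_D2[OF T] by argo
    have slope: "\<bar>g 1 v0 * (v - v0)\<bar> \<le> r * \<bar>v - v0\<bar>"
      using r by (simp add: abs_mult mult_right_mono)
    have cube: "\<bar>v - v0\<bar> ^ 3 = \<bar>v - v0\<bar> * (v - v0)\<^sup>2"
      by (simp add: power3_eq_cube power2_eq_square)
    have lt1: "\<bar>v - v0\<bar> \<le> 1" using v v0 by auto
    have "B * \<bar>v - v0\<bar> ^ 3 \<le> B * (v - v0)\<^sup>2"
      unfolding cube using lt1 \<open>0 < B\<close> by (simp add: mult_left_le_one_le)
    moreover have "g 2 v0 * (v - v0)\<^sup>2 / 2 \<le> k * (v - v0)\<^sup>2"
      using mult_right_mono[OF g2(2), of "(v - v0)\<^sup>2"] by simp
    moreover have "0 \<le> B * (v - v0)\<^sup>2" using \<open>0 < B\<close> by simp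
    ultimately show "g 0 v - g 0 v0 \<le> r * \<bar>v - v0\<bar> + A * (v - v0)\<^sup>2"
      using upper abs_le_D1[OF slope] unfolding A_def distrib_right by linarith
    show "- r * \<bar>v - v0\<bar> + a * (v - v0)\<^sup>2 \<le> g 0 v - g 0 v0"
    proof (cases "\<bar>v - v0\<bar> \<le> d")
      case True
      have "B * \<bar>v - v0\<bar> ^ 3 \<le> k / 2 * (v - v0)\<^sup>2"
        unfolding cube mult.assoc[symmetric] using True \<open>0 < B\<close>
        by (intro mult_right_mono) (auto simp: d_def field_simps)
      moreover have "5 * k / 8 * (v - v0)\<^sup>2 \<le> g 2 v0 * (v - v0)\<^sup>2"
        by (intro mult_right_mono g2) auto
      moreover have "a * (v - v0)\<^sup>2 \<le> k / 8 * (v - v0)\<^sup>2"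
        by (intro mult_right_mono) (auto simp: a_def)
      moreover have "0 \<le> k * (v - v0)\<^sup>2" using k by simp
      ultimately show ?thesis
        using lower abs_le_D2[OF slope] by argo
    next
      case False
      have lip: "\<bar>f y - f z\<bar> \<le> C * \<bar>y - z\<bar>" if "y \<in> {0<..<1}" "z \<in> {0<..<1}"
        "\<And>t. t \<in> {0<..<1} \<Longrightarrow> (f has_real_derivative f' t) (at t)"
        "\<And>t. t \<in> {0<..<1} \<Longrightarrow> \<bar>f' t\<bar> \<le> C" for f f' :: "real \<Rightarrow> real" and y z C
        using field_differentiable_bound[of "{0<..<1::real}" f f' C y z] that
        by (auto intro: has_field_derivative_at_within)
      have g1: "\<bar>g 1 x\<bar> \<le> \<Lambda>" if x: "x \<in> {0<..<1}" for x
      proof -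
        have g2x: "\<bar>g 2 t\<bar> \<le> 2 * k + B" if t: "t \<in> {0<..<1}" for t
        proof -
          have "\<bar>g 2 t - g 2 v0\<bar> \<le> B * \<bar>t - v0\<bar>"
            by (rule lip[of _ _ _ "g 3"]) (use D g3 t v0 in \<open>auto simp: numeral_3_eq_3 numeral_2_eq_2\<close>)
          also have "\<dots> \<le> B" using t v0 \<open>0 < B\<close> by auto
          finally show ?thesis using g2 k by linarith
        qed
        have "\<bar>g 1 x - g 1 v0\<bar> \<le> (2 * k + B) * \<bar>x - v0\<bar>"
          by (rule lip[of _ _ _ "g 2"]) (use D g2x x v0 in \<open>auto simp: numeral_2_eq_2\<close>)
        also have "\<dots> \<le> 2 * k + B" using x v0 k \<open>0 < B\<close> by auto
        finally show ?thesis using r by (simp add: \<Lambda>_def)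
      qed
      obtain p where p: "p \<in> P" "p \<in> {0<..<1}" "\<bar>v - p\<bar> \<le> 1 / N"
      proof -
        define n where "n = nat \<lfloor>v * N\<rfloor>"
        \<comment> \<open>The maximum replaces 0, which lies outside the open interval, by the grid
          point \<open>1 / N\<close>; the distance to \<open>v\<close> is still at most
          \<open>1 / N\<close>.\<close>
        define i where "i = max 1 n"
        have n: "real n \<le> v * N" "v * N < real n + 1" "0 < v * N"
          using v N0 by (auto simp: n_def)
        have "v * N < N" using v N0 by simp
        then have "real n < N" using n by linarith
        then have i: "i \<in> {1..<N}" using N' by (auto simp: i_def)
        have "real i = real n \<or> real n = 0 \<and> real i = 1" by (auto simp: i_def)
        then have "\<bar>v * N - i\<bar> \<le> 1" using n by linarith
        then have "\<bar>v - i / N\<bar> \<le> 1 / N" using N0 by (simp add: field_simps abs_le_iff)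
        then show ?thesis using that[of "i / N"] i N0 by (auto simp: P_def)
      qed
      have "\<bar>g 0 v - g 0 p\<bar> \<le> \<Lambda> * \<bar>v - p\<bar>"
        by (rule lip[of _ _ _ "g 1"]) (use D g1 v p in auto)
      also have "\<dots> \<le> \<Lambda> / N" using p(3) \<Lambda> mult_left_mono[of "\<bar>v - p\<bar>" "1 / N" \<Lambda>] by simp
      finally have "g 0 p - s / 4 \<le> g 0 v" using N1(2) by linarith
      moreover have "L p - e \<le> g 0 p" using gP p by (auto simp: abs_le_iff)
      moreover have "L v0 + s \<le> L p" using False p(3) N1 by (intro s p) linarith
      ultimately have "s / 2 \<le> g 0 v - g 0 v0" using P3(1) e(3) by linarith
      moreover have "a * (v - v0)\<^sup>2 \<le> s / 2"
        using mult_mono[of a "s / 2" "(v - v0)\<^sup>2" 1] lt1 s by (simp add: a_def abs_square_le_1)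
      moreover have "0 \<le> r * \<bar>v - v0\<bar>" using r by auto
      ultimately show ?thesis by simp
    qed
  qed
qed

section \<open>Gaussian moments and the mean of a posterior between Gaussian weights\<close>

text \<open>Symmetry doubles the odd moment on the half-line to 1; the rescaling by
  \<open>sqrt b\<close> then yields one factor \<open>1 / sqrt b\<close> from the measure and one
  from the distance.\<close>

lemma gaussian_abs_moment:
  fixes b m :: real
  assumes "0 < b"
  shows "has_bochner_integral lborel (\<lambda>v. \<bar>v - m\<bar> * exp (- b * (v - m)\<^sup>2)) (1 / b)"
proof -
  have half: "has_bochner_integral lborel (\<lambda>x::real. indicator {0..} x *\<^sub>R (exp (-x\<^sup>2) * \<bar>x\<bar>)) (1 / 2)"
    using gaussian_moment_odd_pos[of 0]
    by (rule has_bochner_integral_cong[THEN iffD1, rotated -1]) (auto simp: indicator_def)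
  have "has_bochner_integral lborel (\<lambda>x::real. exp (-x\<^sup>2) * \<bar>x\<bar>) 1"
    using has_bochner_integral_even_function[OF half] by simp
  then have "has_bochner_integral lborel (\<lambda>v. exp (- (- sqrt b * m + sqrt b * v)\<^sup>2) * \<bar>- sqrt b * m + sqrt b * v\<bar>)
      (1 / \<bar>sqrt b\<bar>)"
    using lborel_has_bochner_integral_real_affine_iff[of "sqrt b" "\<lambda>x. exp (-x\<^sup>2) * \<bar>x\<bar>" 1 "- sqrt b * m"] assms
    by (simp add: inverse_eq_divide)
  then have "has_bochner_integral lborel (\<lambda>v. 1 / sqrt b * (exp (- (- sqrt b * m + sqrt b * v)\<^sup>2) * \<bar>- sqrt b * m + sqrt b * v\<bar>))
      (1 / sqrt b * (1 / \<bar>sqrt b\<bar>))"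
    using has_bochner_integral_mult_right by blast
  moreover have "1 / sqrt b * (exp (- (- sqrt b * m + sqrt b * v)\<^sup>2) * \<bar>- sqrt b * m + sqrt b * v\<bar>) =
      \<bar>v - m\<bar> * exp (- b * (v - m)\<^sup>2)" for v
  proof -
    have "- sqrt b * m + sqrt b * v = sqrt b * (v - m)" by (simp add: algebra_simps)
    then show ?thesis
      using assms by (simp add: power_mult_distrib abs_mult)
  qed
  moreover have "1 / sqrt b * (1 / \<bar>sqrt b\<bar>) = 1 / b" using assms by simp
  ultimately show ?thesis by simp
qed

text \<open>A Laplace-type estimate. The lower parabola bounds the first absolute moment around
  \<open>v0\<close> by a multiple of \<open>1 / n\<close>, the upper one bounds the total mass below
  by a multiple of \<open>1 / sqrt n\<close>, and the quotient has order
  \<open>1 / sqrt n\<close>.\<close>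

lemma posterior_mean_bound:
  fixes f :: "real \<Rightarrow> real"
  assumes m: "f \<in> borel_measurable borel"
    and "0 < a" "0 < A" "0 \<le> K" "0 < n"
    and nbhd: "1 / sqrt n < v0" "v0 + 1 / sqrt n < 1"
    and lower: "\<And>v. v \<in> {0<..<1} \<Longrightarrow> - (K / sqrt n) * \<bar>v - v0\<bar> + a * (v - v0)\<^sup>2 \<le> f v - f v0"
    and upper: "\<And>v. v \<in> {0<..<1} \<Longrightarrow> f v - f v0 \<le> K / sqrt n * \<bar>v - v0\<bar> + A * (v - v0)\<^sup>2"
  shows "\<bar>(LINT v:{0<..<1}|lborel. v * exp (- n * f v)) / (LINT v:{0<..<1}|lborel. exp (- n * f v)) - v0\<bar>
    \<le> exp (K\<^sup>2 / (2 * a) + K + A) / a / sqrt n"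
proof -
  define w where "w v = exp (- n * (f v - f v0))" for v
  have [measurable]: "f \<in> borel_measurable borel" by fact
  have [measurable]: "w \<in> borel_measurable borel" unfolding w_def by measurable
  have sq: "sqrt n > 0" "n = sqrt n * sqrt n" using \<open>0 < n\<close> by auto
  have "0 < 1 / sqrt n" using sq by simp
  then have v0: "0 < v0" "v0 < 1" using nbhd by linarith+
  have w_pos: "0 < w v" for v by (simp add: w_def)
  have w_le: "w v \<le> exp (K\<^sup>2 / (2 * a)) * exp (- (a * n / 2) * (v - v0)\<^sup>2)" if "v \<in> {0<..<1}" for v
  proof -
    define t where "t = sqrt n * \<bar>v - v0\<bar>"
    have t2: "n * (v - v0)\<^sup>2 = t\<^sup>2" using \<open>0 < n\<close> by (simp add: t_def power_mult_distrib)
    have Kt: "n * (K / sqrt n * \<bar>v - v0\<bar>) = K * t"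
      using sq by (simp add: t_def real_div_sqrt field_simps)
    have "n * (- (K / sqrt n) * \<bar>v - v0\<bar> + a * (v - v0)\<^sup>2) \<le> n * (f v - f v0)"
      by (intro mult_left_mono lower that) (use \<open>0 < n\<close> in auto)
    then have "- (K * t) + a * t\<^sup>2 \<le> n * (f v - f v0)"
      unfolding Kt[symmetric] t2[symmetric] by (simp add: algebra_simps)
    \<comment> \<open>Completing the square absorbs the linear term \<open>K * t\<close> at the
      price of half the quadratic term and the constant \<open>K\<^sup>2 / (2 * a)\<close>.\<close>
    moreover have "0 \<le> (K / a - t)\<^sup>2 * (a / 2)" using \<open>0 < a\<close> by simp
    moreover have "(K / a - t)\<^sup>2 * (a / 2) = K\<^sup>2 / (2 * a) + a * t\<^sup>2 / 2 - K * t"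
      using \<open>0 < a\<close> by (simp add: power2_eq_square field_simps)
    ultimately have "- n * (f v - f v0) \<le> K\<^sup>2 / (2 * a) - a / 2 * (n * (v - v0)\<^sup>2)"
      unfolding t2 by argo
    then show ?thesis by (simp add: w_def exp_add[symmetric] mult_ac)
  qed
  have w_bd: "w v \<le> exp (K\<^sup>2 / (2 * a))" if "v \<in> {0<..<1}" for v
    using w_le[OF that] \<open>0 < a\<close> \<open>0 < n\<close>
    by (elim order_trans) (simp add: mult_le_cancel_left1)
  have int: "set_integrable lborel {0<..<1} (\<lambda>v. h v * w v)"
    if [measurable]: "h \<in> borel_measurable borel" and h: "\<And>v. v \<in> {0<..<1} \<Longrightarrow> \<bar>h v\<bar> \<le> 1" for h
    unfolding set_integrable_def
  proof (rule Bochner_Integration.integrable_bound[where f = "\<lambda>v. indicator {0<..<1::real} v *\<^sub>R exp (K\<^sup>2 / (2 * a))"])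
    show "AE v in lborel. norm (indicator {0<..<1} v *\<^sub>R (h v * w v))
        \<le> norm (indicator {0<..<1::real} v *\<^sub>R exp (K\<^sup>2 / (2 * a)))"
      using mult_mono[OF h w_bd, of _ _ ] w_pos by (auto simp: indicator_def abs_mult less_imp_le)
  qed auto
  define W where "W = (LINT v:{0<..<1}|lborel. w v)"
  have int_w: "set_integrable lborel {0<..<1} w" using int[of "\<lambda>_. 1"] by simp
  have int_v: "set_integrable lborel {0<..<1} (\<lambda>v. v * w v)" by (rule int) auto
  have int_c: "set_integrable lborel {0<..<1} (\<lambda>v. \<bar>v - v0\<bar> * w v)"
    by (rule int) (use v0 in auto)
  \<comment> \<open>On the window of radius \<open>1 / sqrt n\<close> around \<open>v0\<close>, the
    two terms of the upper bound, multiplied by \<open>n\<close>, are at most \<open>K\<close> and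
    \<open>A\<close>; so the mass is at least the window's length times a constant.\<close>
  have W_ge: "2 / sqrt n * exp (- K - A) \<le> W"
  proof -
    have sub: "{v0 - 1 / sqrt n..v0 + 1 / sqrt n} \<subseteq> {0<..<1}" using nbhd by auto
    have "w v \<ge> exp (- K - A)" if "v \<in> {v0 - 1 / sqrt n..v0 + 1 / sqrt n}" for v
    proof -
      have x: "\<bar>v - v0\<bar> \<le> 1 / sqrt n" using that by (auto simp: abs_le_iff)
      have "K / sqrt n * \<bar>v - v0\<bar> \<le> K / sqrt n * (1 / sqrt n)"
        using x \<open>0 \<le> K\<close> sq by (intro mult_left_mono) auto
      moreover have "(v - v0)\<^sup>2 \<le> (1 / sqrt n)\<^sup>2" using x sq by (intro power2_le_iff_abs_le[THEN iffD2]) auto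
      then have "A * (v - v0)\<^sup>2 \<le> A * (1 / n)" using \<open>0 < A\<close> \<open>0 < n\<close>
        by (intro mult_left_mono) (auto simp: power_divide)
      ultimately have "f v - f v0 \<le> K / n + A / n"
        using upper[of v] that nbhd sq \<open>0 < n\<close> by (simp flip: sq(2))
      then have "n * (f v - f v0) \<le> K + A" using \<open>0 < n\<close> by (simp add: field_simps)
      then show ?thesis by (simp add: w_def)
    qed
    then have "(LINT v:{v0 - 1 / sqrt n..v0 + 1 / sqrt n}|lborel. exp (- K - A))
        \<le> (LINT v:{v0 - 1 / sqrt n..v0 + 1 / sqrt n}|lborel. w v)"
      by (intro set_integral_mono set_integrable_subset[OF int_w _ sub] borel_integrable_atLeastAtMost') auto
    also have "\<dots> \<le> W"
      unfolding W_def set_lebesgue_integral_def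
    proof (rule integral_mono)
      show "integrable lborel (\<lambda>v. indicator {v0 - 1 / sqrt n..v0 + 1 / sqrt n} v *\<^sub>R w v)"
        using set_integrable_subset[OF int_w _ sub] by (simp add: set_integrable_def)
    qed (use int_w sub w_pos in \<open>auto simp: set_integrable_def indicator_def less_imp_le\<close>)
    finally show ?thesis using sq by (simp add: set_lebesgue_integral_def)
  qed
  then have W_pos: "0 < W" using sq by (smt (verit) divide_pos_pos exp_gt_zero mult_pos_pos)
  have num: "(LINT v:{0<..<1}|lborel. \<bar>v - v0\<bar> * w v) \<le> exp (K\<^sup>2 / (2 * a)) * (2 / (a * n))"
  proof -
    have G: "has_bochner_integral lborel (\<lambda>v. \<bar>v - v0\<bar> * exp (- (a * n / 2) * (v - v0)\<^sup>2)) (2 / (a * n))"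
      using gaussian_abs_moment[of "a * n / 2" v0] \<open>0 < a\<close> \<open>0 < n\<close> by simp
    have "(LINT v:{0<..<1}|lborel. \<bar>v - v0\<bar> * w v)
        \<le> (\<integral>v. exp (K\<^sup>2 / (2 * a)) * (\<bar>v - v0\<bar> * exp (- (a * n / 2) * (v - v0)\<^sup>2)) \<partial>lborel)"
      unfolding set_lebesgue_integral_def
    proof (rule integral_mono)
      show "indicator {0<..<1} v *\<^sub>R (\<bar>v - v0\<bar> * w v)
          \<le> exp (K\<^sup>2 / (2 * a)) * (\<bar>v - v0\<bar> * exp (- (a * n / 2) * (v - v0)\<^sup>2))" for v
        using mult_left_mono[OF w_le, of v "\<bar>v - v0\<bar>"] by (simp add: indicator_def mult_ac)
    qed (use int_c G in \<open>auto simp: set_integrable_def has_bochner_integral_iff\<close>)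
    also have "\<dots> = exp (K\<^sup>2 / (2 * a)) * (2 / (a * n))"
      using G by (simp only: integral_mult_right_zero has_bochner_integral_integral_eq)
    finally show ?thesis .
  qed
  define E where "E = exp (- n * f v0)"
  have E: "exp (- n * f v) = w v * E" for v
    by (simp add: w_def E_def algebra_simps flip: exp_add)
  have "0 < E" by (simp add: E_def)
  then have "\<bar>(LINT v:{0<..<1}|lborel. v * exp (- n * f v)) / (LINT v:{0<..<1}|lborel. exp (- n * f v)) - v0\<bar>
      = \<bar>(LINT v:{0<..<1}|lborel. v * w v) / W - v0\<bar>"
    unfolding E W_def mult.assoc[symmetric] set_integral_mult_left by simp
  also have "\<dots> = \<bar>(LINT v:{0<..<1}|lborel. v * w v) - (LINT v:{0<..<1}|lborel. v0 * w v)\<bar> / W"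
    using W_pos by (simp add: W_def field_simps)
  also have "(LINT v:{0<..<1}|lborel. v * w v) - (LINT v:{0<..<1}|lborel. v0 * w v) = (LINT v:{0<..<1}|lborel. (v - v0) * w v)"
    using int_v int_w by (simp add: left_diff_distrib)
  also have "\<bar>\<dots>\<bar> \<le> (LINT v:{0<..<1}|lborel. \<bar>v - v0\<bar> * w v)"
    unfolding set_lebesgue_integral_def
    by (rule order_trans[OF integral_abs_bound], rule eq_refl, rule Bochner_Integration.integral_cong)
       (auto simp: indicator_def abs_mult less_imp_le[OF w_pos])
  also note num
  also have "exp (K\<^sup>2 / (2 * a)) * (2 / (a * n)) / W \<le> exp (K\<^sup>2 / (2 * a)) * (2 / (a * n)) / (2 / sqrt n * exp (- K - A))"
    by (rule divide_left_mono[OF W_ge]) (use sq \<open>0 < a\<close> \<open>0 < n\<close> W_pos in auto)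
  also have "\<dots> = exp (K\<^sup>2 / (2 * a) + K + A) / a / sqrt n"
    unfolding exp_add exp_diff exp_minus
    by (subst (1) sq(2)) (use sq(1) \<open>0 < a\<close> in \<open>simp add: divide_simps\<close>)
  finally show ?thesis using W_pos by (simp add: divide_right_mono)
qed

section \<open>Normalisation of a copula density and differentiation under the integral sign\<close>

lemma AE_lborel_Ioo_witness:
  fixes a b :: real
  assumes "AE v in lborel. P v" "a < b"
  obtains v where "v \<in> {a<..<b}" "P v"
proof (rule ccontr)
  assume "\<not> thesis"
  then have "AE v in lborel. v \<notin> {a<..<b}"
    using assms(1) that by (auto elim!: eventually_mono)
  then have "{a<..<b} \<in> null_sets lborel"
    by (subst AE_iff_null_sets) auto
  then have "emeasure lborel {a<..<b} = 0" by auto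
  then show False using \<open>a < b\<close> by simp
qed

text \<open>\<open>copula_density\<close> fixes the margin only for almost every \<open>v\<close>.
  By the dominated derivative, \<open>c u\<close> is Lipschitz in \<open>v\<close> with constant
  \<open>F u\<close>, so the integral is Lipschitz as well and the value 1 spreads from a dense set
  to every \<open>v\<close>. The integral of \<open>c'\<close> is then, by dominated convergence, a
  limit of integrals of difference quotients, all of which are 0.\<close>

lemma
  fixes c c' :: "real \<Rightarrow> real \<Rightarrow> real"
  assumes cop: "copula_density c"
    and F: "set_integrable lborel {0<..<1} F"
    and deriv: "\<And>u v. u \<in> {0<..<1} \<Longrightarrow> v \<in> {0<..<1} \<Longrightarrow> (c u has_real_derivative c' u v) (at v)"
    and bound: "\<And>u v. u \<in> {0<..<1} \<Longrightarrow> v \<in> {0<..<1} \<Longrightarrow> \<bar>c' u v\<bar> \<le> F u"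
    and v: "v \<in> {0<..<1}"
  shows copula_density_set_integrable: "set_integrable lborel {0<..<1} (\<lambda>u. c u v)"
    and copula_density_set_integral: "(LINT u:{0<..<1}|lborel. c u v) = 1"
    and copula_density_deriv_set_integral: "(LINT u:{0<..<1}|lborel. c' u v) = 0"
proof -
  let ?I = "{0<..<1::real}"
  have "(\<lambda>(u, v). c u v) \<in> borel_measurable (borel \<Otimes>\<^sub>M borel)"
    using cop by (simp add: copula_density_def)
  then have [measurable]: "(\<lambda>u. c u v) \<in> borel_measurable borel" for v
    using measurable_compose[of "\<lambda>u. (u, v)" borel "borel \<Otimes>\<^sub>M borel" "\<lambda>(u, v). c u v" borel] by simp
  have nonneg: "0 \<le> c u v" if "u \<in> ?I" "v \<in> ?I" for u v
    using cop that by (auto simp: copula_density_def)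
  have lip: "\<bar>c u y - c u z\<bar> \<le> F u * \<bar>y - z\<bar>" if "u \<in> ?I" "y \<in> ?I" "z \<in> ?I" for u y z
  proof -
    have "norm (c u y - c u z) \<le> F u * norm (y - z)"
    proof (rule field_differentiable_bound[of ?I "c u" "c' u"])
      show "(c u has_field_derivative c' u w) (at w within ?I)" "norm (c' u w) \<le> F u" if "w \<in> ?I" for w
        using deriv[OF \<open>u \<in> ?I\<close> that] bound[OF \<open>u \<in> ?I\<close> that] by (auto intro: has_field_derivative_at_within)
    qed (use that in auto)
    then show ?thesis by simp
  qed
  have AE1: "AE w in lborel. w \<in> ?I \<longrightarrow> (\<integral>\<^sup>+u\<in>?I. ennreal (c u w) \<partial>lborel) = 1"
    using cop by (simp add: copula_density_def)
  have unit: "set_integrable lborel ?I (\<lambda>u. c u w) \<and> (LINT u:?I|lborel. c u w) = 1"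
    if w: "w \<in> ?I" and 1: "(\<integral>\<^sup>+u\<in>?I. ennreal (c u w) \<partial>lborel) = 1" for w
  proof -
    have "(\<integral>\<^sup>+u. ennreal (indicator ?I u *\<^sub>R c u w) \<partial>lborel) = ennreal 1"
      unfolding 1[symmetric] ennreal_1 by (intro nn_integral_cong) (auto simp: indicator_def)
    then have "has_bochner_integral lborel (\<lambda>u. indicator ?I u *\<^sub>R c u w) 1"
      by (intro has_bochner_integral_nn_integral) (use w nonneg in \<open>auto simp: indicator_def\<close>)
    then show ?thesis
      by (auto simp: set_integrable_def set_lebesgue_integral_def has_bochner_integral_iff)
  qed
  have diff_int: "set_integrable lborel ?I (\<lambda>u. c u y - c u z)"
    and diff_le: "\<bar>LINT u:?I|lborel. c u y - c u z\<bar> \<le> (LINT u:?I|lborel. F u) * \<bar>y - z\<bar>"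
    if yz: "y \<in> ?I" "z \<in> ?I" for y z
  proof -
    have Fi: "set_integrable lborel ?I (\<lambda>u. F u * \<bar>y - z\<bar>)" using F by simp
    show *: "set_integrable lborel ?I (\<lambda>u. c u y - c u z)"
      unfolding set_integrable_def
    proof (rule Bochner_Integration.integrable_bound[OF Fi[unfolded set_integrable_def]])
      show "AE u in lborel. norm (indicator ?I u *\<^sub>R (c u y - c u z)) \<le> norm (indicator ?I u *\<^sub>R (F u * \<bar>y - z\<bar>))"
        using order_trans[OF lip[OF _ yz] abs_ge_self] by (auto simp: indicator_def)
    qed simp
    have "\<bar>LINT u:?I|lborel. c u y - c u z\<bar> \<le> (LINT u:?I|lborel. \<bar>c u y - c u z\<bar>)"
      using set_integral_norm_bound[OF *] by simp
    also have "\<dots> \<le> (LINT u:?I|lborel. F u * \<bar>y - z\<bar>)"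
      by (rule set_integral_mono) (use * Fi lip yz in \<open>auto intro: set_integrable_abs\<close>)
    finally show "\<bar>LINT u:?I|lborel. c u y - c u z\<bar> \<le> (LINT u:?I|lborel. F u) * \<bar>y - z\<bar>" by simp
  qed
  have near: "\<exists>z. z \<in> ?I \<and> \<bar>y - z\<bar> < d \<and> (\<integral>\<^sup>+u\<in>?I. ennreal (c u z) \<partial>lborel) = 1"
    if y: "y \<in> ?I" and "0 < d" for y d
  proof -
    obtain z where "z \<in> {max 0 (y - d)<..<y}" "z \<in> ?I \<longrightarrow> (\<integral>\<^sup>+u\<in>?I. ennreal (c u z) \<partial>lborel) = 1"
      using AE_lborel_Ioo_witness[OF AE1, of "max 0 (y - d)" y] y \<open>0 < d\<close> by auto
    then show ?thesis using y by (intro exI[of _ z]) auto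
  qed
  have int: "set_integrable lborel ?I (\<lambda>u. c u y)" if y: "y \<in> ?I" for y
  proof -
    obtain z where z: "z \<in> ?I" "(\<integral>\<^sup>+u\<in>?I. ennreal (c u z) \<partial>lborel) = 1"
      using near[OF y zero_less_one] by blast
    have "set_integrable lborel ?I (\<lambda>u. (c u y - c u z) + c u z)"
      using unit[OF z] diff_int[OF y z(1)] by (intro set_integral_add(1)) auto
    then show ?thesis by simp
  qed
  have eq1: "(LINT u:?I|lborel. c u y) = 1" if y: "y \<in> ?I" for y
  proof -
    define C where "C = (LINT u:?I|lborel. F u)"
    have close: "\<bar>(LINT u:?I|lborel. c u y) - 1\<bar> \<le> \<bar>C\<bar> * d" if "0 < d" for d
    proof -
      obtain z where z: "z \<in> ?I" "\<bar>y - z\<bar> < d" "(\<integral>\<^sup>+u\<in>?I. ennreal (c u z) \<partial>lborel) = 1"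
        using near[OF y \<open>0 < d\<close>] by blast
      have "\<bar>(LINT u:?I|lborel. c u y) - 1\<bar> = \<bar>LINT u:?I|lborel. c u y - c u z\<bar>"
        using unit[OF z(1,3)] int[OF y] by simp
      also have "\<dots> \<le> C * \<bar>y - z\<bar>" unfolding C_def by (rule diff_le[OF y z(1)])
      also have "\<dots> \<le> \<bar>C\<bar> * d" using z(2) by (intro mult_mono) auto
      finally show ?thesis .
    qed
    have "\<bar>(LINT u:?I|lborel. c u y) - 1\<bar> \<le> 0"
    proof (rule field_le_epsilon)
      fix e :: real assume "0 < e"
      have "\<bar>(LINT u:?I|lborel. c u y) - 1\<bar> \<le> \<bar>C\<bar> * (e / (\<bar>C\<bar> + 1))"
        using \<open>0 < e\<close> by (intro close) auto
      also have "\<dots> \<le> e" using \<open>0 < e\<close> by (simp add: divide_simps mult_left_mono)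
      finally show "\<bar>(LINT u:?I|lborel. c u y) - 1\<bar> \<le> 0 + e" by simp
    qed
    then show ?thesis by simp
  qed
  show "set_integrable lborel ?I (\<lambda>u. c u v)" "(LINT u:?I|lborel. c u v) = 1"
    using int eq1 v by auto
  define h where "h n = (1 - v) / (real n + 2)" for n
  have h: "h n > 0" "v + h n \<in> ?I" for n
  proof -
    show "h n > 0" using v by (simp add: h_def)
    have "h n < 1 - v" using v by (simp add: h_def divide_simps)
    then show "v + h n \<in> ?I" using v \<open>h n > 0\<close> by auto
  qed
  have h0: "h \<longlonglongrightarrow> 0" unfolding h_def
    by (rule real_tendsto_divide_at_top) (auto intro!: filterlim_tendsto_add_at_top filterlim_real_sequentially
        simp: add.commute[of _ 2])
  define q where "q n u = indicator ?I u *\<^sub>R ((c u (v + h n) - c u v) / h n)" for n u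
  have q_lim: "(\<lambda>n. q n u) \<longlonglongrightarrow> indicator ?I u *\<^sub>R c' u v" for u
  proof (cases "u \<in> ?I")
    case True
    have "((\<lambda>t. (c u (v + t) - c u v) / t) \<longlongrightarrow> c' u v) (at 0)"
      using deriv[OF True v] by (simp add: DERIV_def)
    moreover have "filterlim h (at 0) sequentially"
      using h0 h(1) by (auto simp: filterlim_at intro!: always_eventually less_imp_neq[symmetric])
    ultimately have "(\<lambda>n. (c u (v + h n) - c u v) / h n) \<longlonglongrightarrow> c' u v"
      by (rule filterlim_compose)
    then show ?thesis using True by (simp add: q_def)
  qed (simp add: q_def)
  have q_meas: "q n \<in> borel_measurable lborel" for n unfolding q_def by measurable
  have "(\<lambda>n. integral\<^sup>L lborel (q n)) \<longlonglongrightarrow> (\<integral>u. indicator ?I u *\<^sub>R c' u v \<partial>lborel)"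
  proof (rule integral_dominated_convergence[where w = "\<lambda>u. indicator ?I u *\<^sub>R F u"])
    \<comment> \<open>Measurability of \<open>c'\<close> in \<open>u\<close> comes from the
      quotients \<open>q n\<close>, whose limit it is.\<close>
    show "(\<lambda>u. indicator ?I u *\<^sub>R c' u v) \<in> borel_measurable lborel"
      by (rule borel_measurable_LIMSEQ_real[OF q_lim q_meas])
    show "AE u in lborel. norm (q n u) \<le> indicator ?I u *\<^sub>R F u" for n
    proof (intro AE_I2)
      fix u
      show "norm (q n u) \<le> indicator ?I u *\<^sub>R F u"
        using lip[of u "v + h n" v] h[of n] v by (auto simp: q_def indicator_def divide_simps)
    qed
  qed (use F q_lim q_meas in \<open>auto simp: set_integrable_def\<close>)
  moreover have "integral\<^sup>L lborel (q n) = 0" for n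
  proof -
    have "integral\<^sup>L lborel (q n) = (LINT u:?I|lborel. (c u (v + h n) - c u v) / h n)"
      unfolding q_def[abs_def] set_lebesgue_integral_def ..
    also have "\<dots> = 0"
      using int[OF h(2)] int[OF v] eq1[OF h(2)] eq1[OF v] by simp
    finally show ?thesis .
  qed
  ultimately show "(LINT u:?I|lborel. c' u v) = 0"
    by (simp add: set_lebesgue_integral_def LIMSEQ_const_iff)
qed

section \<open>Second moments of sums of independent variables\<close>

text \<open>Bienayme's identity: independence and centring make the cross term of each new summand
  vanish. Integrability is part of the conclusion so that the induction can use it for the partial
  sum.\<close>

lemma (in prob_space) second_moment_indep_sum:
  fixes X :: "'i \<Rightarrow> 'a \<Rightarrow> real"
  assumes "finite I" "indep_vars (\<lambda>_. borel) X I"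
    and "\<And>i. i \<in> I \<Longrightarrow> integrable M (\<lambda>\<omega>. (X i \<omega>)\<^sup>2)" "\<And>i. i \<in> I \<Longrightarrow> expectation (X i) = 0"
  shows "integrable M (\<lambda>\<omega>. (\<Sum>i\<in>I. X i \<omega>)\<^sup>2) \<and>
    expectation (\<lambda>\<omega>. (\<Sum>i\<in>I. X i \<omega>)\<^sup>2) = (\<Sum>i\<in>I. expectation (\<lambda>\<omega>. (X i \<omega>)\<^sup>2))"
  using assms
proof (induction I rule: finite_induct)
  case (insert i I)
  have rv [measurable]: "random_variable borel (X j)" if "j \<in> insert i I" for j
    using insert.prems(1) that by (auto simp: indep_vars_def)
  define S where "S \<omega> = (\<Sum>j\<in>I. X j \<omega>)" for \<omega>
  have "indep_vars (\<lambda>_. borel) X I"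
    using insert.prems(1) by (rule indep_vars_subset) auto
  then have S2: "integrable M (\<lambda>\<omega>. (S \<omega>)\<^sup>2)"
    "expectation (\<lambda>\<omega>. (S \<omega>)\<^sup>2) = (\<Sum>j\<in>I. expectation (\<lambda>\<omega>. (X j \<omega>)\<^sup>2))"
    using insert.IH insert.prems by (auto simp: S_def)
  have Smeas: "random_variable borel S" unfolding S_def using rv by auto
  have int: "integrable M (X i)" "integrable M S"
    using square_integrable_imp_integrable[of "X i"] square_integrable_imp_integrable[OF Smeas S2(1)]
      rv insert.prems by auto
  have ind: "indep_var borel (X i) borel S"
    unfolding S_def by (rule indep_vars_sum) (use insert in auto)
  have cross: "integrable M (\<lambda>\<omega>. X i \<omega> * S \<omega>)" "expectation (\<lambda>\<omega>. X i \<omega> * S \<omega>) = 0"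
    using indep_var_integrable[OF ind int] indep_var_lebesgue_integral[OF ind int] insert.prems by auto
  have "(\<Sum>j\<in>insert i I. X j \<omega>)\<^sup>2 = (X i \<omega>)\<^sup>2 + 2 * (X i \<omega> * S \<omega>) + (S \<omega>)\<^sup>2" for \<omega>
    using insert.hyps by (simp add: S_def power2_sum)
  then show ?case
    using insert cross S2 by simp
qed simp

section \<open>Densities, scores and laws of the observations given the latent value\<close>

locale regular_factor_model =
  fixes M :: "'a measure" and U :: "nat \<Rightarrow> 'a \<Rightarrow> real"
    and c :: "nat \<Rightarrow> real \<Rightarrow> real \<Rightarrow> real" and v0 :: real
  assumes linking: "\<And>j. 1 \<le> j \<Longrightarrow> copula_density (c j)"
    and latent: "v0 \<in> {0<..<1}"
    and model: "observed_given_latent M c v0 U"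
    and regular: "ml_regular c v0"
begin

sublocale prob_space M
  using model by (simp add: observed_given_latent_def)

lemma indep_obs: "indep_vars (\<lambda>_. borel) U {1..}"
  using model by (simp add: observed_given_latent_def)

lemma measurable_obs [measurable]: "1 \<le> j \<Longrightarrow> U j \<in> borel_measurable M"
  using indep_obs by (auto simp: indep_vars_def)

lemma measurable_density:
  assumes "1 \<le> j" and [measurable]: "f \<in> borel_measurable N" "g \<in> borel_measurable N"
  shows "(\<lambda>x. c j (f x) (g x)) \<in> borel_measurable N"
proof -
  have "(\<lambda>(u, v). c j u v) \<in> borel_measurable (borel \<Otimes>\<^sub>M borel)"
    using linking[OF \<open>1 \<le> j\<close>] by (simp add: copula_density_def)
  then show ?thesis
    using measurable_compose[of "\<lambda>x. (f x, g x)" N "borel \<Otimes>\<^sub>M borel" "\<lambda>(u, v). c j u v" borel] by simp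
qed

lemma density_pos: "1 \<le> j \<Longrightarrow> u \<in> {0<..<1} \<Longrightarrow> v \<in> {0<..<1} \<Longrightarrow> 0 < c j u v"
  using regular by (auto simp: ml_regular_def)

lemma log_density_DERIV:
  assumes "1 \<le> j" "u \<in> {0<..<1}" "v \<in> {0<..<1}" "m < 3"
  shows "((deriv ^^ m) (\<lambda>v. ln (c j u v)) has_real_derivative (deriv ^^ Suc m) (\<lambda>v. ln (c j u v)) v) (at v)"
proof -
  have "(deriv ^^ m) (\<lambda>v. ln (c j u v)) differentiable_on {0<..<1}"
    using regular assms by (auto simp: ml_regular_def)
  then have "(deriv ^^ m) (\<lambda>v. ln (c j u v)) differentiable at v"
    using assms(3) by (auto simp: differentiable_on_eq_differentiable_at)
  then show ?thesis by (simp add: DERIV_deriv_iff_real_differentiable)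
qed

text \<open>Smoothness is assumed for the log-density; exponentiating transfers it to the
  density.\<close>

lemma density_DERIV:
  assumes "1 \<le> j" "u \<in> {0<..<1}" "v \<in> {0<..<1}"
  shows "(c j u has_real_derivative score (c j) u v * c j u v) (at v)"
proof (rule has_field_derivative_transform_within_open[where S = "{0<..<1}"])
  show "((\<lambda>v. exp (ln (c j u v))) has_real_derivative score (c j) u v * c j u v) (at v)"
    by (rule DERIV_cong[OF DERIV_chain2[OF DERIV_exp log_density_DERIV[OF assms, of 0, simplified]]])
       (use density_pos[OF assms] in \<open>simp add: score_def\<close>)
qed (use assms density_pos in auto)

text \<open>The dominating function in \<open>ml_regular\<close> bounds
  \<open>deriv (c j u)\<close>, which is the score times the density; the copula lemmas therefore
  apply with this product as \<open>c'\<close>.\<close>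

lemma
  assumes "1 \<le> j" "v \<in> {0<..<1}"
  shows density_set_integrable: "set_integrable lborel {0<..<1} (\<lambda>u. c j u v)"
    and density_set_integral: "(LINT u:{0<..<1}|lborel. c j u v) = 1"
    and score_set_integral: "(LINT u:{0<..<1}|lborel. score (c j) u v * c j u v) = 0"
proof -
  have "\<forall>j\<ge>1. \<exists>F. set_integrable lborel {0<..<1} F \<and> (\<forall>u\<in>{0<..<1}. \<forall>v\<in>{0<..<1}.
      \<bar>deriv (c j u) v\<bar> \<le> F u \<and> \<bar>(deriv ^^ 2) (c j u) v\<bar> \<le> F u)"
    using regular unfolding ml_regular_def by (elim conjE)
  from this[THEN spec, THEN mp, OF assms(1)] obtain F where F: "set_integrable lborel {0<..<1} F"
    "\<forall>u\<in>{0<..<1}. \<forall>v\<in>{0<..<1}. \<bar>deriv (c j u) v\<bar> \<le> F u \<and> \<bar>(deriv ^^ 2) (c j u) v\<bar> \<le> F u"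
    by (elim exE conjE)
  have bd: "\<bar>score (c j) u v * c j u v\<bar> \<le> F u" if "u \<in> {0<..<1}" "v \<in> {0<..<1}" for u v
    using F(2)[THEN bspec, THEN bspec, OF that, THEN conjunct1] DERIV_imp_deriv[OF density_DERIV[OF assms(1) that]] by simp
  note * = linking[OF assms(1)] F(1) density_DERIV[OF assms(1)] bd assms(2)
  show "set_integrable lborel {0<..<1} (\<lambda>u. c j u v)" "(LINT u:{0<..<1}|lborel. c j u v) = 1"
    "(LINT u:{0<..<1}|lborel. score (c j) u v * c j u v) = 0"
    by (rule copula_density_set_integrable[OF *] copula_density_set_integral[OF *]
        copula_density_deriv_set_integral[OF *]; assumption)+
qed

lemma obs_distributed:
  assumes "1 \<le> j"
  shows "distributed M lborel (U j) (\<lambda>u. ennreal (c j u v0 * indicator {0<..<1} u))"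
proof -
  have "(\<lambda>u. ennreal (c j u v0 * indicator {0<..<1} u)) = (\<lambda>u. ennreal (c j u v0) * indicator {0<..<1} u)"
    by (auto simp: indicator_def)
  then show ?thesis using model assms by (simp add: observed_given_latent_def)
qed

lemma
  assumes "1 \<le> j" "g \<in> borel_measurable borel"
  shows integrable_obs_iff: "integrable M (\<lambda>\<omega>. g (U j \<omega>)) \<longleftrightarrow> set_integrable lborel {0<..<1} (\<lambda>u. g u * c j u v0)"
    and expectation_obs: "expectation (\<lambda>\<omega>. g (U j \<omega>)) = (LINT u:{0<..<1}|lborel. g u * c j u v0)"
proof -
  have nn: "0 \<le> c j u v0 * indicator {0<..<1} u" for u
    using density_pos[OF assms(1) _ latent, of u] by (auto simp: indicator_def)
  have eq: "(\<lambda>u. c j u v0 * indicator {0<..<1} u * g u) = (\<lambda>u. indicator {0<..<1} u *\<^sub>R (g u * c j u v0))"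
    by (auto simp: mult_ac)
  have g: "g \<in> borel_measurable lborel" using assms by simp
  show "integrable M (\<lambda>\<omega>. g (U j \<omega>)) \<longleftrightarrow> set_integrable lborel {0<..<1} (\<lambda>u. g u * c j u v0)"
    using distributed_integrable[OF obs_distributed[OF assms(1)] g nn] unfolding eq set_integrable_def by simp
  show "expectation (\<lambda>\<omega>. g (U j \<omega>)) = (LINT u:{0<..<1}|lborel. g u * c j u v0)"
    using distributed_integral[OF obs_distributed[OF assms(1)] g nn] unfolding eq set_lebesgue_integral_def by simp
qed

text \<open>Positivity and smoothness of the densities are known on the open unit square only, so
  the pathwise estimates are made on this event. Countably many indices allow a single null
  set.\<close>

lemma AE_obs_unit: "AE \<omega> in M. \<forall>j\<ge>1. U j \<omega> \<in> {0<..<1}"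
proof -
  have "AE \<omega> in M. 1 \<le> j \<longrightarrow> U j \<omega> \<in> {0<..<1}" for j
  proof (cases "1 \<le> j")
    case True
    have "emeasure M (U j -` (- {0<..<1}) \<inter> space M) = 0"
      by (subst distributed_emeasure[OF obs_distributed[OF True]])
         (auto intro!: nn_integral_zero' simp: indicator_def)
    then have "U j -` (- {0<..<1}) \<inter> space M \<in> null_sets M"
      using measurable_sets[OF measurable_obs[OF True], of "- {0<..<1}"] by (auto simp: null_sets_def)
    then show ?thesis by (rule AE_I') auto
  qed simp
  then show ?thesis by (simp add: AE_all_countable)
qed

text \<open>Cut off because nothing is known about the score, not even measurability, off the unit interval.\<close>

definition "score0 j u = indicator {0<..<1} u * score (c j) u v0"

text \<open>The score is a pointwise limit of difference quotients along a fixed null sequence, and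
  each quotient is measurable in \<open>u\<close>.\<close>

lemma measurable_score0:
  assumes "1 \<le> j"
  shows "score0 j \<in> borel_measurable borel"
proof (rule borel_measurable_LIMSEQ_real)
  define h where "h n = (1 - v0) / (real n + 2)" for n
  have h: "h n > 0" "h \<longlonglongrightarrow> 0" for n
    using latent unfolding h_def
    by (auto intro!: real_tendsto_divide_at_top filterlim_tendsto_add_at_top filterlim_real_sequentially
        simp: add.commute[of _ 2])
  fix u :: real
  show "(\<lambda>n. indicator {0<..<1} u * ((ln (c j u (v0 + h n)) - ln (c j u v0)) / h n)) \<longlonglongrightarrow> score0 j u"
  proof (cases "u \<in> {0<..<1}")
    case True
    have "((\<lambda>t. (ln (c j u (v0 + t)) - ln (c j u v0)) / t) \<longlongrightarrow> score (c j) u v0) (at 0)"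
      using log_density_DERIV[OF assms True latent, of 0] by (simp add: DERIV_def score_def)
    moreover have "filterlim h (at 0) sequentially"
      using h by (auto simp: filterlim_at intro!: always_eventually less_imp_neq[symmetric])
    ultimately have "(\<lambda>n. (ln (c j u (v0 + h n)) - ln (c j u v0)) / h n) \<longlonglongrightarrow> score (c j) u v0"
      by (rule filterlim_compose)
    then show ?thesis using True by (simp add: score0_def)
  qed (simp add: score0_def)
next
  have [measurable]: "(\<lambda>u. c j u v) \<in> borel_measurable borel" for v
    using measurable_density[OF assms, of "\<lambda>u. u" borel "\<lambda>_. v"] by simp
  show "(\<lambda>u. indicator {0<..<1} u * ((ln (c j u (v0 + (1 - v0) / (real n + 2))) - ln (c j u v0)) / ((1 - v0) / (real n + 2))))
      \<in> borel_measurable borel" for n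
    by measurable
qed

lemma score0_sq_integrable: "1 \<le> j \<Longrightarrow> integrable M (\<lambda>\<omega>. (score0 j (U j \<omega>))\<^sup>2)"
  and expectation_score0_sq: "1 \<le> j \<Longrightarrow> expectation (\<lambda>\<omega>. (score0 j (U j \<omega>))\<^sup>2) = fisher_info (c j) v0"
  and expectation_score0: "1 \<le> j \<Longrightarrow> expectation (\<lambda>\<omega>. score0 j (U j \<omega>)) = 0"
proof -
  assume j: "1 \<le> j"
  note m = measurable_score0[OF j]
  have m2: "(\<lambda>u. (score0 j u)\<^sup>2) \<in> borel_measurable borel"
    using m by (rule borel_measurable_power)
  have eq: "indicator {0<..<1} u *\<^sub>R ((score0 j u)\<^sup>2 * c j u v0) = indicator {0<..<1} u *\<^sub>R ((score (c j) u v0)\<^sup>2 * c j u v0)"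
    "indicator {0<..<1} u *\<^sub>R (score0 j u * c j u v0) = indicator {0<..<1} u *\<^sub>R (score (c j) u v0 * c j u v0)" for u
    by (auto simp: score0_def indicator_def)
  have "\<forall>j\<ge>1. set_integrable lborel {0<..<1} (\<lambda>u. (score (c j) u v0)\<^sup>2 * c j u v0)"
    using regular unfolding ml_regular_def by (elim conjE)
  then have "set_integrable lborel {0<..<1} (\<lambda>u. (score (c j) u v0)\<^sup>2 * c j u v0)"
    using j by simp
  then show "integrable M (\<lambda>\<omega>. (score0 j (U j \<omega>))\<^sup>2)"
    using integrable_obs_iff[OF j m2] by (simp only: set_integrable_def eq)
  show "expectation (\<lambda>\<omega>. (score0 j (U j \<omega>))\<^sup>2) = fisher_info (c j) v0"
    using expectation_obs[OF j m2] by (simp only: set_lebesgue_integral_def eq fisher_info_def)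
  show "expectation (\<lambda>\<omega>. score0 j (U j \<omega>)) = 0"
    using expectation_obs[OF j m] score_set_integral[OF j latent]
    by (simp only: set_lebesgue_integral_def eq)
qed

section \<open>Tightness of the score sum and of the third derivatives\<close>

text \<open>Chebyshev's inequality: the second moment of the sum is the total Fisher information,
  which is eventually below \<open>(I + 1) * D\<close>.\<close>

lemma score_sum_tight:
  assumes "0 < e"
  shows "\<exists>K>0. \<forall>\<^sub>F D in sequentially.
    prob {\<omega>\<in>space M. K * sqrt (real D) < \<bar>\<Sum>j=1..D. score0 j (U j \<omega>)\<bar>} < e"
proof -
  obtain I where I: "I > 0" "(\<lambda>D. (\<Sum>j=1..D. fisher_info (c j) v0) / real D) \<longlonglongrightarrow> I"
    using regular unfolding ml_regular_def by (elim conjE exE)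
  \<comment> \<open>Makes the Chebyshev bound \<open>(I + 1) / K\<^sup>2\<close> equal to
    \<open>e / 2\<close>.\<close>
  define K where "K = sqrt (2 * (I + 1) / e)"
  have K: "0 < K" "K\<^sup>2 = 2 * (I + 1) / e" using I assms by (auto simp: K_def)
  have "\<forall>\<^sub>F D in sequentially. (\<Sum>j=1..D. fisher_info (c j) v0) / real D < I + 1"
    using order_tendstoD(2)[OF I(2)] by simp
  then have "\<forall>\<^sub>F D in sequentially.
      prob {\<omega>\<in>space M. K * sqrt (real D) < \<bar>\<Sum>j=1..D. score0 j (U j \<omega>)\<bar>} < e"
    using eventually_ge_at_top[of 1]
  proof eventually_elim
    fix D :: nat assume D: "1 \<le> D" and fi: "(\<Sum>j=1..D. fisher_info (c j) v0) / real D < I + 1"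
    let ?S = "\<lambda>\<omega>. \<Sum>j=1..D. score0 j (U j \<omega>)"
    have [measurable]: "(\<lambda>\<omega>. score0 j (U j \<omega>)) \<in> borel_measurable M" if "1 \<le> j" for j
      using measurable_compose[OF measurable_obs[OF that] measurable_score0[OF that]] .
    have [measurable]: "?S \<in> borel_measurable M" by (intro borel_measurable_sum) auto
    have "indep_vars (\<lambda>_. borel) (\<lambda>j \<omega>. score0 j (U j \<omega>)) {1..D}"
      by (rule indep_vars_compose2[OF indep_vars_subset[OF indep_obs]]) (auto intro: measurable_score0)
    then have S: "integrable M (\<lambda>\<omega>. (?S \<omega>)\<^sup>2)"
      "expectation (\<lambda>\<omega>. (?S \<omega>)\<^sup>2) = (\<Sum>j=1..D. fisher_info (c j) v0)"
      using second_moment_indep_sum[of "{1..D}" "\<lambda>j \<omega>. score0 j (U j \<omega>)"]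
      by (auto simp: score0_sq_integrable expectation_score0 expectation_score0_sq)
    have pos: "0 < K * sqrt (real D)" using K D by simp
    have "prob {\<omega>\<in>space M. K * sqrt (real D) < \<bar>?S \<omega>\<bar>} \<le> prob {\<omega>\<in>space M. \<bar>?S \<omega>\<bar> \<ge> K * sqrt (real D)}"
      by (intro finite_measure_mono) auto
    also have "\<dots> \<le> (\<Sum>j=1..D. fisher_info (c j) v0) / (K * sqrt (real D))\<^sup>2"
      using second_moment_method[OF _ S(1) pos] S(2) by simp
    also have "\<dots> = (\<Sum>j=1..D. fisher_info (c j) v0) / real D / K\<^sup>2"
      by (simp add: power_mult_distrib mult.commute)
    also have "\<dots> \<le> (I + 1) / K\<^sup>2" using fi by (intro divide_right_mono) auto
    also have "\<dots> < e" using K I assms by (simp add: field_simps)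
    finally show "prob {\<omega>\<in>space M. K * sqrt (real D) < \<bar>?S \<omega>\<bar>} < e" .
  qed
  then show ?thesis using K(1) by blast
qed

text \<open>Markov's inequality for the sum of the dominating functions, whose expectations are
  uniformly bounded. The same \<open>H\<close> serves all \<open>v\<close> at once, which makes the
  resulting bound on the third derivative uniform.\<close>

lemma third_derivative_tight:
  assumes "0 < e"
  shows "\<exists>B>0. \<exists>H. (\<forall>j\<ge>1. H j \<in> borel_measurable borel) \<and>
    (\<forall>j\<ge>1. \<forall>u\<in>{0<..<1}. \<forall>v\<in>{0<..<1}. \<bar>(deriv ^^ 3) (\<lambda>v. ln (c j u v)) v\<bar> \<le> H j u) \<and>
    (\<forall>D\<ge>1. prob {\<omega>\<in>space M. B * real D < (\<Sum>j=1..D. H j (U j \<omega>))} < e)"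
proof -
  define Q where "Q j H B \<longleftrightarrow>
      (\<forall>u\<in>{0<..<1}. \<forall>v\<in>{0<..<1}. \<bar>(deriv ^^ 3) (\<lambda>v. ln (c j u v)) v\<bar> \<le> H u) \<and>
      set_integrable lborel {0<..<1} (\<lambda>u. H u * c j u v0) \<and>
      (LINT u:{0<..<1}|lborel. H u * c j u v0) \<le> B" for j H B
  have "\<exists>B. \<forall>j\<ge>1. \<exists>H. Q j H B"
    using regular unfolding ml_regular_def Q_def by (elim conjE)
  then obtain B0 where B0: "\<forall>j\<ge>1. \<exists>H. Q j H B0" by blast
  define H0 where "H0 j = (SOME H. Q j H B0)" for j
  have Q: "Q j (H0 j) B0" if "1 \<le> j" for j
    unfolding H0_def by (rule someI_ex[OF B0[rule_format, OF that]])
  note Q' = Q[unfolded Q_def]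
  note H0 = Q'[THEN conjunct1, THEN bspec, THEN bspec] Q'[THEN conjunct2, THEN conjunct1]
    Q'[THEN conjunct2, THEN conjunct2]
  define H where "H j u = indicator {0<..<1} u * H0 j u" for j u
  \<comment> \<open>Gives \<open>\<bar>B0\<bar> / B < e\<close>; the added 1 keeps \<open>B\<close>
    positive if \<open>B0\<close> is 0.\<close>
  define B where "B = 2 * (\<bar>B0\<bar> + 1) / e"
  have B: "0 < B" using assms by (simp add: B_def)
  have Hm: "H j \<in> borel_measurable borel" if j: "1 \<le> j" for j
  proof -
    have [measurable]: "(\<lambda>u. c j u v0) \<in> borel_measurable borel"
      using measurable_density[OF j, of "\<lambda>u. u" borel "\<lambda>_. v0"] by simp
    have [measurable]: "(\<lambda>u. indicator {0<..<1} u *\<^sub>R (H0 j u * c j u v0)) \<in> borel_measurable borel"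
      using H0(2)[OF j] by (auto simp: set_integrable_def dest: borel_measurable_integrable)
    \<comment> \<open>Regularity gives measurability of the dominating function only through its
      integrable product with the density at \<open>v0\<close>, so that positive factor is divided
      out.\<close>
    have "H j = (\<lambda>u. (indicator {0<..<1} u *\<^sub>R (H0 j u * c j u v0)) / c j u v0)"
      using density_pos[OF j _ latent] by (force simp: H_def indicator_def)
    also have "\<dots> \<in> borel_measurable borel" by measurable
    finally show ?thesis .
  qed
  have H_nonneg: "0 \<le> H j u" if "1 \<le> j" for j u
    using order_trans[OF abs_ge_zero H0(1)[OF that _ latent]] by (auto simp: H_def indicator_def)
  have eq: "indicator {0<..<1} u *\<^sub>R (H j u * c j u v0) = indicator {0<..<1} u *\<^sub>R (H0 j u * c j u v0)" for j u
    by (simp add: H_def indicator_def)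
  have H_int: "integrable M (\<lambda>\<omega>. H j (U j \<omega>))" if "1 \<le> j" for j
    using integrable_obs_iff[OF that Hm[OF that]] H0(2)[OF that] by (simp only: set_integrable_def eq)
  have H_exp: "expectation (\<lambda>\<omega>. H j (U j \<omega>)) \<le> B0" if "1 \<le> j" for j
    using expectation_obs[OF that Hm[OF that]] H0(3)[OF that] by (simp only: set_lebesgue_integral_def eq)
  have "prob {\<omega>\<in>space M. B * real D < (\<Sum>j=1..D. H j (U j \<omega>))} < e" if D: "1 \<le> D" for D
  proof -
    let ?S = "\<lambda>\<omega>. \<Sum>j=1..D. H j (U j \<omega>)"
    have S_int: "integrable M ?S" by (intro Bochner_Integration.integrable_sum H_int) auto
    then have [measurable]: "?S \<in> borel_measurable M" by (rule borel_measurable_integrable)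
    have "expectation ?S = (\<Sum>j=1..D. expectation (\<lambda>\<omega>. H j (U j \<omega>)))"
      by (intro Bochner_Integration.integral_sum H_int) auto
    also have "\<dots> \<le> (\<Sum>j=1..D. \<bar>B0\<bar>)"
      by (intro sum_mono order_trans[OF H_exp]) auto
    finally have S_exp: "expectation ?S \<le> real D * \<bar>B0\<bar>" by simp
    have "prob {\<omega>\<in>space M. B * real D < ?S \<omega>} \<le> prob {\<omega>\<in>space M. ?S \<omega> \<ge> B * real D}"
      by (intro finite_measure_mono) (auto simp del: One_nat_def)
    also have "\<dots> \<le> expectation ?S / (B * real D)"
      by (rule integral_Markov_inequality_measure[OF S_int, of "{}"])
         (use B D H_nonneg in \<open>auto intro!: sum_nonneg\<close>)
    also have "\<dots> \<le> real D * \<bar>B0\<bar> / (B * real D)"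
      using S_exp B D by (intro divide_right_mono) auto
    also have "\<dots> = \<bar>B0\<bar> / B" using D by simp
    also have "\<dots> < e"
    proof -
      have "e * B = 2 * (\<bar>B0\<bar> + 1)" using assms by (simp add: B_def)
      then show ?thesis by (simp add: pos_divide_less_eq[OF B])
    qed
    finally show ?thesis .
  qed
  moreover have "\<bar>(deriv ^^ 3) (\<lambda>v. ln (c j u v)) v\<bar> \<le> H j u"
    if "1 \<le> j" "u \<in> {0<..<1}" "v \<in> {0<..<1}" for j u v
    using H0(1)[OF that] that by (simp add: H_def)
  ultimately show ?thesis using B Hm by blast
qed

section \<open>Measurability of the statistics, likelihood ratios and the minimum of the
  limit\<close>

lemma measurable_avg_nll_obs [measurable]: "(\<lambda>\<omega>. avg_nll c D (\<lambda>j. U j \<omega>) v) \<in> borel_measurable M"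
  unfolding avg_nll_def
  by (intro borel_measurable_divide borel_measurable_uminus borel_measurable_sum borel_measurable_ln
      measurable_density) (auto intro: measurable_obs)

lemma measurable_proxy: "(\<lambda>\<omega>. proxy c D (\<lambda>j. U j \<omega>)) \<in> borel_measurable M"
proof -
  have "(\<lambda>(\<omega>, v). \<Prod>j=1..D. c j (U j \<omega>) v) \<in> borel_measurable (M \<Otimes>\<^sub>M lborel)"
    unfolding case_prod_beta
  proof (intro borel_measurable_prod measurable_density)
    fix j assume "j \<in> {1..D}"
    then show "(\<lambda>x. U j (fst x)) \<in> borel_measurable (M \<Otimes>\<^sub>M lborel)"
      by (intro measurable_compose[OF measurable_fst] measurable_obs) auto
  qed auto
  note [measurable] = this
  show ?thesis
    unfolding proxy_def factor_copula_density_def set_lebesgue_integral_def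
    by (intro borel_measurable_divide lborel.borel_measurable_lebesgue_integral) measurable
qed

lemma prod_density_eq_exp:
  assumes "1 \<le> D" "\<And>j. 1 \<le> j \<Longrightarrow> u j \<in> {0<..<1}" "v \<in> {0<..<1}"
  shows "(\<Prod>j=1..D. c j (u j) v) = exp (- real D * avg_nll c D u v)"
proof -
  have "- real D * avg_nll c D u v = (\<Sum>j=1..D. ln (c j (u j) v))"
    using assms(1) by (simp add: avg_nll_def)
  also have "exp \<dots> = (\<Prod>j=1..D. exp (ln (c j (u j) v)))"
    by (simp add: exp_sum)
  also have "\<dots> = (\<Prod>j=1..D. c j (u j) v)"
    using assms density_pos by (intro prod.cong) auto
  finally show ?thesis by simp
qed

text \<open>
  Markov's inequality for the likelihood ratio, which has mean 1. It takes the place of the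
  information inequality, for which the log-densities would have to be integrable.
\<close>

lemma likelihood_ratio_Markov:
  assumes v: "v \<in> {0<..<1}" and D: "1 \<le> D"
  shows "prob {\<omega>\<in>space M. e \<le> avg_nll c D (\<lambda>j. U j \<omega>) v0 - avg_nll c D (\<lambda>j. U j \<omega>) v} \<le> exp (- real D * e)"
proof -
  \<comment> \<open>The cut-off makes the ratio nonnegative at every real \<open>u\<close>, which is
    used for Markov's inequality below.\<close>
  define r where "r j u = indicator {0<..<1} u * (c j u v / c j u v0)" for j u
  have r_meas: "r j \<in> borel_measurable borel" if "1 \<le> j" for j
  proof -
    have [measurable]: "(\<lambda>u. c j u w) \<in> borel_measurable borel" for w
      using measurable_density[OF that, of "\<lambda>u. u" borel "\<lambda>_. w"] by simp
    show ?thesis unfolding r_def[abs_def] by measurable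
  qed
  \<comment> \<open>The density at \<open>v0\<close> cancels, so the ratio has the integral of
    \<open>c j u v\<close>, which is 1, as its mean.\<close>
  have eq: "indicator {0<..<1} u *\<^sub>R (r j u * c j u v0) = indicator {0<..<1} u *\<^sub>R c j u v" if "1 \<le> j" for j u
    using density_pos[OF that _ latent, of u] by (auto simp: r_def indicator_def)
  have r_int: "integrable M (\<lambda>\<omega>. r j (U j \<omega>))" if "1 \<le> j" for j
    using integrable_obs_iff[OF that r_meas[OF that]] density_set_integrable[OF that v]
    by (simp only: set_integrable_def eq[OF that])
  have r_exp: "expectation (\<lambda>\<omega>. r j (U j \<omega>)) = 1" if "1 \<le> j" for j
    using expectation_obs[OF that r_meas[OF that]] density_set_integral[OF that v]
    by (simp only: set_lebesgue_integral_def eq[OF that])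
  have ind: "indep_vars (\<lambda>_. borel) (\<lambda>j \<omega>. r j (U j \<omega>)) {1..D}"
    by (rule indep_vars_compose2[OF indep_vars_subset[OF indep_obs]]) (auto intro: r_meas)
  let ?R = "\<lambda>\<omega>. \<Prod>j=1..D. r j (U j \<omega>)"
  have R_int: "integrable M ?R"
    by (rule indep_vars_integrable[OF _ ind]) (auto intro: r_int)
  have "expectation ?R = (\<Prod>j=1..D. expectation (\<lambda>\<omega>. r j (U j \<omega>)))"
    by (rule indep_vars_lebesgue_integral[OF _ ind]) (auto intro: r_int)
  also have "\<dots> = 1" by (intro prod.neutral) (auto intro: r_exp)
  finally have R_exp: "expectation ?R = 1" .
  have r_nonneg: "0 \<le> r j u" if "1 \<le> j" for j u
    using density_pos[OF that _ latent, of u] density_pos[OF that _ v, of u]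
    by (auto simp: r_def indicator_def less_imp_le)
  have "prob {\<omega>\<in>space M. e \<le> avg_nll c D (\<lambda>j. U j \<omega>) v0 - avg_nll c D (\<lambda>j. U j \<omega>) v}
      \<le> prob {\<omega>\<in>space M. exp (real D * e) \<le> ?R \<omega>}"
  proof (rule finite_measure_mono_AE)
    show "AE \<omega> in M. \<omega> \<in> {\<omega>\<in>space M. e \<le> avg_nll c D (\<lambda>j. U j \<omega>) v0 - avg_nll c D (\<lambda>j. U j \<omega>) v}
        \<longrightarrow> \<omega> \<in> {\<omega>\<in>space M. exp (real D * e) \<le> ?R \<omega>}"
      using AE_obs_unit
    proof eventually_elim
      fix \<omega> assume unit: "\<forall>j\<ge>1. U j \<omega> \<in> {0<..<1}"
      have "?R \<omega> = (\<Prod>j=1..D. c j (U j \<omega>) v) / (\<Prod>j=1..D. c j (U j \<omega>) v0)"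
        unfolding prod_dividef[symmetric] by (intro prod.cong) (use unit in \<open>auto simp: r_def\<close>)
      also have "\<dots> = exp (real D * (avg_nll c D (\<lambda>j. U j \<omega>) v0 - avg_nll c D (\<lambda>j. U j \<omega>) v))"
        using prod_density_eq_exp[OF D _ v, of "\<lambda>j. U j \<omega>"] prod_density_eq_exp[OF D _ latent, of "\<lambda>j. U j \<omega>"] unit
        by (simp add: exp_diff[symmetric] algebra_simps del: One_nat_def)
      finally show "\<omega> \<in> {\<omega>\<in>space M. e \<le> avg_nll c D (\<lambda>j. U j \<omega>) v0 - avg_nll c D (\<lambda>j. U j \<omega>) v}
        \<longrightarrow> \<omega> \<in> {\<omega>\<in>space M. exp (real D * e) \<le> ?R \<omega>}"
        by (simp add: mult_left_mono del: One_nat_def)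
    qed
    show "{\<omega>\<in>space M. exp (real D * e) \<le> ?R \<omega>} \<in> sets M"
      using borel_measurable_integrable[OF R_int] by measurable
  qed
  also have "\<dots> \<le> expectation ?R / exp (real D * e)"
    by (rule integral_Markov_inequality_measure[OF R_int, of "{}"]) (auto intro!: prod_nonneg r_nonneg)
  also have "\<dots> = exp (- real D * e)" by (simp only: R_exp exp_minus inverse_eq_divide mult_minus_left)
  finally show ?thesis .
qed

text \<open>A smaller limit at \<open>v\<close> would force, for each \<open>D\<close>, a large
  deviation at \<open>v0\<close>, one at \<open>v\<close>, or a likelihood ratio of exponential
  size. These events cover the space although their probabilities tend to 0.\<close>

lemma limit_nll_minimal_at_latent:
  assumes lim: "\<And>v. v \<in> {0<..<1} \<Longrightarrow> tendsto_in_prob M (\<lambda>D \<omega>. avg_nll c D (\<lambda>j. U j \<omega>) v) (L v)"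
    and v: "v \<in> {0<..<1}"
  shows "L v0 \<le> L v"
proof (rule ccontr)
  assume "\<not> L v0 \<le> L v"
  define d where "d = (L v0 - L v) / 3"
  have d: "d > 0" using \<open>\<not> L v0 \<le> L v\<close> by (simp add: d_def)
  let ?X = "\<lambda>w D \<omega>. avg_nll c D (\<lambda>j. U j \<omega>) w"
  let ?E = "\<lambda>w D. {\<omega>\<in>space M. d < \<bar>?X w D \<omega> - L w\<bar>}"
  let ?G = "\<lambda>D. {\<omega>\<in>space M. d \<le> ?X v0 D \<omega> - ?X v D \<omega>}"
  have E: "(\<lambda>D. prob (?E w D)) \<longlonglongrightarrow> 0" if "w \<in> {0<..<1}" for w
    using lim[OF that] d by (simp add: tendsto_in_prob_def)
  have "(\<lambda>D. exp (- real D * d)) \<longlonglongrightarrow> 0"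
    using d by real_asymp
  then have "(\<lambda>D. prob (?E v0 D) + prob (?E v D) + exp (- real D * d)) \<longlonglongrightarrow> 0 + 0 + 0"
    by (intro tendsto_add E latent v)
  then have "\<forall>\<^sub>F D in sequentially. prob (?E v0 D) + prob (?E v D) + exp (- real D * d) < 1"
    by (auto dest: order_tendstoD(2)[where a = 1])
  then have "\<forall>\<^sub>F D in sequentially. False"
    using eventually_ge_at_top[of 1]
  proof eventually_elim
    fix D :: nat assume lt: "prob (?E v0 D) + prob (?E v D) + exp (- real D * d) < 1" and D: "1 \<le> D"
    \<comment> \<open>If both averages are within \<open>d\<close> of limits that are
      \<open>3 * d\<close> apart, their difference is at least \<open>d\<close>.\<close>
    have "3 * d = L v0 - L v" by (simp add: d_def)
    then have "d < \<bar>?X v0 D \<omega> - L v0\<bar> \<or> d < \<bar>?X v D \<omega> - L v\<bar> \<or> d \<le> ?X v0 D \<omega> - ?X v D \<omega>" for \<omega>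
      by linarith
    then have "space M \<subseteq> ?E v0 D \<union> ?E v D \<union> ?G D" by blast
    then have "prob (space M) \<le> prob (?E v0 D \<union> ?E v D \<union> ?G D)"
      by (intro finite_measure_mono) auto
    also have "\<dots> \<le> prob (?E v0 D) + prob (?E v D) + prob (?G D)"
      by (intro order_trans[OF measure_Un_le] add_mono order_refl measure_Un_le) auto
    also have "prob (?G D) \<le> exp (- real D * d)" by (rule likelihood_ratio_Markov[OF v D])
    finally show False using lt by (simp add: prob_space)
  qed
  then show False by simp
qed

section \<open>From the growth bounds to the rate of the proxy\<close>

text \<open>The deterministic core: the random quantities appear as arbitrary sequences
  \<open>u\<close> and \<open>h\<close>, and the complements of the exceptional events as premises.
  The points \<open>P\<close>, the constants and the threshold for \<open>D\<close> are chosen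
  before \<open>u\<close> and \<open>h\<close>.\<close>

lemma proxy_bound:
  assumes min: "global_min_at L v0" and conv: "strictly_locally_convex_at L v0"
    and "0 < B" "0 < K"
  shows "\<exists>P e C. finite P \<and> P \<subseteq> {0<..<1} \<and> 0 < e \<and> 0 < C \<and>
    (\<forall>\<^sub>F D in sequentially. \<forall>u h. (\<forall>j\<ge>1. u j \<in> {0<..<1}) \<longrightarrow>
      (\<forall>j\<ge>1. \<forall>v\<in>{0<..<1}. \<bar>(deriv ^^ 3) (\<lambda>v. ln (c j (u j) v)) v\<bar> \<le> h j) \<longrightarrow>
      (\<Sum>j=1..D. h j) \<le> B * real D \<longrightarrow>
      \<bar>\<Sum>j=1..D. score0 j (u j)\<bar> \<le> K * sqrt (real D) \<longrightarrow>
      (\<forall>p\<in>P. \<bar>avg_nll c D u p - L p\<bar> \<le> e) \<longrightarrow>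
      \<bar>proxy c D u - v0\<bar> \<le> C / sqrt (real D))"
proof -
  obtain P e a A where P: "finite P" "P \<subseteq> {0<..<1}" "0 < e" and aA: "0 < a" "0 < A"
    and growth: "\<forall>g r. (\<forall>m<3. \<forall>v\<in>{0<..<1}. (g m has_real_derivative g (Suc m) v) (at v)) \<longrightarrow>
        (\<forall>v\<in>{0<..<1}. \<bar>g 3 v\<bar> \<le> B) \<longrightarrow> (\<forall>p\<in>P. \<bar>g 0 p - L p\<bar> \<le> e) \<longrightarrow>
        \<bar>g 1 v0\<bar> \<le> r \<longrightarrow> r \<le> K \<longrightarrow>
        (\<forall>v\<in>{0<..<1}. - r * \<bar>v - v0\<bar> + a * (v - v0)\<^sup>2 \<le> g 0 v - g 0 v0 \<and>
            g 0 v - g 0 v0 \<le> r * \<bar>v - v0\<bar> + A * (v - v0)\<^sup>2)"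
    using quadratic_growth_from_finitely_many_points[OF min conv \<open>0 < B\<close> less_imp_le[OF \<open>0 < K\<close>]]
    by (elim exE conjE)
  define C where "C = exp (K\<^sup>2 / (2 * a) + K + A) / a"
  have C: "0 < C" using aA by (simp add: C_def)
  have "(\<lambda>D. 1 / sqrt (real D)) \<longlonglongrightarrow> 0" by real_asymp
  \<comment> \<open>The window on which the posterior mass is bounded below has to fit into the unit
    interval.\<close>
  then have "\<forall>\<^sub>F D in sequentially. 1 / sqrt (real D) < min v0 (1 - v0)"
    using latent by (intro order_tendstoD(2)) auto
  then have "\<forall>\<^sub>F D in sequentially. \<forall>u h. (\<forall>j\<ge>1. u j \<in> {0<..<1}) \<longrightarrow>
      (\<forall>j\<ge>1. \<forall>v\<in>{0<..<1}. \<bar>(deriv ^^ 3) (\<lambda>v. ln (c j (u j) v)) v\<bar> \<le> h j) \<longrightarrow>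
      (\<Sum>j=1..D. h j) \<le> B * real D \<longrightarrow>
      \<bar>\<Sum>j=1..D. score0 j (u j)\<bar> \<le> K * sqrt (real D) \<longrightarrow>
      (\<forall>p\<in>P. \<bar>avg_nll c D u p - L p\<bar> \<le> e) \<longrightarrow>
      \<bar>proxy c D u - v0\<bar> \<le> C / sqrt (real D)"
    using eventually_ge_at_top[of 1]
  proof (eventually_elim, intro allI impI)
    fix D :: nat and u h :: "nat \<Rightarrow> real"
    assume nbhd: "1 / sqrt (real D) < min v0 (1 - v0)" and D: "1 \<le> D"
      and u: "\<forall>j\<ge>1. u j \<in> {0<..<1}"
      and h: "\<forall>j\<ge>1. \<forall>v\<in>{0<..<1}. \<bar>(deriv ^^ 3) (\<lambda>v. ln (c j (u j) v)) v\<bar> \<le> h j"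
      and hsum: "(\<Sum>j=1..D. h j) \<le> B * real D"
      and sc: "\<bar>\<Sum>j=1..D. score0 j (u j)\<bar> \<le> K * sqrt (real D)"
      and close: "\<forall>p\<in>P. \<bar>avg_nll c D u p - L p\<bar> \<le> e"
    \<comment> \<open>The averaged negative log-likelihood with its derivatives;
      \<open>g 1 v0\<close> is minus the averaged score.\<close>
    define g where "g m v = - (\<Sum>j=1..D. (deriv ^^ m) (\<lambda>v. ln (c j (u j) v)) v) / real D" for m v
    have g0: "g 0 = avg_nll c D u" by (simp add: g_def avg_nll_def fun_eq_iff)
    have sD: "1 \<le> sqrt (real D)" "sqrt (real D) * sqrt (real D) = real D" using D by auto
    have "\<forall>m<3. \<forall>v\<in>{0<..<1}. (g m has_real_derivative g (Suc m) v) (at v)"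
    proof (intro allI impI ballI)
      fix m v assume m: "m < (3::nat)" and v: "v \<in> {0<..<1::real}"
      show "(g m has_real_derivative g (Suc m) v) (at v)"
        unfolding g_def
        by (intro DERIV_cdivide DERIV_minus DERIV_sum log_density_DERIV) (use u v m in auto)
    qed
    moreover have "\<forall>v\<in>{0<..<1}. \<bar>g 3 v\<bar> \<le> B"
    proof
      fix v :: real assume v: "v \<in> {0<..<1}"
      have "\<bar>\<Sum>j=1..D. (deriv ^^ 3) (\<lambda>v. ln (c j (u j) v)) v\<bar> \<le> (\<Sum>j=1..D. h j)"
        by (intro order_trans[OF sum_abs] sum_mono) (use h v in auto)
      also note hsum
      finally show "\<bar>g 3 v\<bar> \<le> B" using D by (simp add: g_def divide_le_eq)
    qed
    moreover have "\<bar>g 1 v0\<bar> \<le> K / sqrt (real D)"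
    proof -
      have "g 1 v0 = - (\<Sum>j=1..D. score0 j (u j)) / real D"
        using u by (simp add: g_def score0_def score_def)
      then have "\<bar>g 1 v0\<bar> \<le> K * sqrt (real D) / real D"
        using sc by (simp add: divide_right_mono del: One_nat_def)
      also have "\<dots> = K / sqrt (real D)" using sD D by (simp add: real_div_sqrt field_simps)
      finally show ?thesis .
    qed
    moreover have "K / sqrt (real D) \<le> K"
      using sD \<open>0 < K\<close> by (simp add: divide_le_eq)
    ultimately have gr: "\<forall>v\<in>{0<..<1}. - (K / sqrt (real D)) * \<bar>v - v0\<bar> + a * (v - v0)\<^sup>2 \<le> g 0 v - g 0 v0 \<and>
            g 0 v - g 0 v0 \<le> K / sqrt (real D) * \<bar>v - v0\<bar> + A * (v - v0)\<^sup>2"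
      using growth[THEN spec[of _ g], THEN spec[of _ "K / sqrt (real D)"]] close unfolding g0 by blast
    have "\<bar>(LINT v:{0<..<1}|lborel. v * exp (- real D * g 0 v)) / (LINT v:{0<..<1}|lborel. exp (- real D * g 0 v)) - v0\<bar>
        \<le> C / sqrt (real D)"
      unfolding C_def
    proof (rule posterior_mean_bound)
      show "g 0 \<in> borel_measurable borel"
        unfolding g0 avg_nll_def
        by (intro borel_measurable_divide borel_measurable_uminus borel_measurable_sum borel_measurable_ln
            measurable_density) auto
    qed (use aA \<open>0 < K\<close> D nbhd gr in auto)
    moreover have "proxy c D u = (LINT v:{0<..<1}|lborel. v * exp (- real D * g 0 v)) / (LINT v:{0<..<1}|lborel. exp (- real D * g 0 v))"
      unfolding proxy_def factor_copula_density_def g0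
      by (intro arg_cong2[where f = "(/)"] set_lebesgue_integral_cong) (use prod_density_eq_exp[OF D] u in auto)
    ultimately show "\<bar>proxy c D u - v0\<bar> \<le> C / sqrt (real D)" by simp
  qed
  then show ?thesis using P C by blast
qed

text \<open>A union bound over three exceptional events, each of probability below
  \<open>e / 3\<close>: a large score sum, a large sum of third-derivative bounds, and a deviation
  of the averaged log-likelihood at some point of \<open>P\<close>.\<close>

lemma proxy_consistency_rate:
  assumes lim: "\<And>v. v \<in> {0<..<1} \<Longrightarrow> tendsto_in_prob M (\<lambda>D \<omega>. avg_nll c D (\<lambda>j. U j \<omega>) v) (L v)"
    and min: "global_min_at L v0" and conv: "strictly_locally_convex_at L v0"
  shows "bigo_in_prob M (\<lambda>D \<omega>. proxy c D (\<lambda>j. U j \<omega>) - v0) (\<lambda>D. real D powr (-1/2))"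
  unfolding bigo_in_prob_def
proof (intro conjI allI impI)
  show "(\<lambda>\<omega>. proxy c D (\<lambda>j. U j \<omega>) - v0) \<in> borel_measurable M" for D
    using measurable_proxy by simp
  fix e :: real assume e: "0 < e"
  then have e3: "0 < e / 3" by simp
  obtain K where K: "0 < K" "\<forall>\<^sub>F D in sequentially.
      prob {\<omega>\<in>space M. K * sqrt (real D) < \<bar>\<Sum>j=1..D. score0 j (U j \<omega>)\<bar>} < e / 3"
    using score_sum_tight[OF e3] by blast
  from third_derivative_tight[OF e3] obtain B H where B: "0 < B" and H_meas: "\<forall>j\<ge>1. H j \<in> borel_measurable borel"
    and H: "\<forall>j\<ge>1. \<forall>u\<in>{0<..<1}. \<forall>v\<in>{0<..<1}. \<bar>(deriv ^^ 3) (\<lambda>v. ln (c j u v)) v\<bar> \<le> H j u"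
    and H_tight: "\<forall>D\<ge>1. prob {\<omega>\<in>space M. B * real D < (\<Sum>j=1..D. H j (U j \<omega>))} < e / 3"
    by (elim exE conjE)
  from proxy_bound[OF min conv B K(1)] obtain P d C where P: "finite P" "P \<subseteq> {0<..<1}" "0 < d" "0 < C"
    and bound: "\<forall>\<^sub>F D in sequentially. \<forall>u h. (\<forall>j\<ge>1. u j \<in> {0<..<1}) \<longrightarrow>
      (\<forall>j\<ge>1. \<forall>v\<in>{0<..<1}. \<bar>(deriv ^^ 3) (\<lambda>v. ln (c j (u j) v)) v\<bar> \<le> h j) \<longrightarrow>
      (\<Sum>j=1..D. h j) \<le> B * real D \<longrightarrow>
      \<bar>\<Sum>j=1..D. score0 j (u j)\<bar> \<le> K * sqrt (real D) \<longrightarrow>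
      (\<forall>p\<in>P. \<bar>avg_nll c D u p - L p\<bar> \<le> d) \<longrightarrow>
      \<bar>proxy c D u - v0\<bar> \<le> C / sqrt (real D)"
    by (elim exE conjE)
  let ?E1 = "\<lambda>D. {\<omega>\<in>space M. K * sqrt (real D) < \<bar>\<Sum>j=1..D. score0 j (U j \<omega>)\<bar>}"
  let ?E2 = "\<lambda>D. {\<omega>\<in>space M. B * real D < (\<Sum>j=1..D. H j (U j \<omega>))}"
  let ?E3 = "\<lambda>p D. {\<omega>\<in>space M. d < \<bar>avg_nll c D (\<lambda>j. U j \<omega>) p - L p\<bar>}"
  \<comment> \<open>Finiteness of \<open>P\<close> is what lets pointwise convergence in probability
    suffice.\<close>
  have "(\<lambda>D. \<Sum>p\<in>P. prob (?E3 p D)) \<longlonglongrightarrow> (\<Sum>p\<in>P. 0)"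
    using lim P by (intro tendsto_sum) (auto simp: tendsto_in_prob_def)
  then have E3: "\<forall>\<^sub>F D in sequentially. (\<Sum>p\<in>P. prob (?E3 p D)) < e / 3"
    using e3 by (intro order_tendstoD(2)) auto
  have "\<forall>\<^sub>F D in sequentially. prob {\<omega>\<in>space M. C * \<bar>real D powr (-1/2)\<bar> < \<bar>proxy c D (\<lambda>j. U j \<omega>) - v0\<bar>} < e"
    using K(2) bound E3 eventually_ge_at_top[of 1]
  proof eventually_elim
    fix D :: nat
    assume E1: "prob (?E1 D) < e / 3" and E3: "(\<Sum>p\<in>P. prob (?E3 p D)) < e / 3" and D: "1 \<le> D"
      and bound: "\<forall>u h. (\<forall>j\<ge>1. u j \<in> {0<..<1}) \<longrightarrow>
      (\<forall>j\<ge>1. \<forall>v\<in>{0<..<1}. \<bar>(deriv ^^ 3) (\<lambda>v. ln (c j (u j) v)) v\<bar> \<le> h j) \<longrightarrow>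
      (\<Sum>j=1..D. h j) \<le> B * real D \<longrightarrow>
      \<bar>\<Sum>j=1..D. score0 j (u j)\<bar> \<le> K * sqrt (real D) \<longrightarrow>
      (\<forall>p\<in>P. \<bar>avg_nll c D u p - L p\<bar> \<le> d) \<longrightarrow>
      \<bar>proxy c D u - v0\<bar> \<le> C / sqrt (real D)"
    have "(\<lambda>\<omega>. \<Sum>j=1..D. score0 j (U j \<omega>)) \<in> borel_measurable M" "(\<lambda>\<omega>. \<Sum>j=1..D. H j (U j \<omega>)) \<in> borel_measurable M"
      by (auto intro!: borel_measurable_sum measurable_compose[OF measurable_obs] measurable_score0 H_meas[rule_format])
    note [measurable] = this
    have meas: "?E1 D \<in> sets M" "?E2 D \<in> sets M" "?E3 p D \<in> sets M" for p by measurable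
    have "prob {\<omega>\<in>space M. C * \<bar>real D powr (-1/2)\<bar> < \<bar>proxy c D (\<lambda>j. U j \<omega>) - v0\<bar>}
        \<le> prob (?E1 D \<union> ?E2 D \<union> (\<Union>p\<in>P. ?E3 p D))"
    proof (rule finite_measure_mono_AE)
      show "?E1 D \<union> ?E2 D \<union> (\<Union>p\<in>P. ?E3 p D) \<in> sets M"
        using meas P(1) by (intro sets.Un sets.finite_UN) auto
      show "AE \<omega> in M. \<omega> \<in> {\<omega>\<in>space M. C * \<bar>real D powr (-1/2)\<bar> < \<bar>proxy c D (\<lambda>j. U j \<omega>) - v0\<bar>}
          \<longrightarrow> \<omega> \<in> ?E1 D \<union> ?E2 D \<union> (\<Union>p\<in>P. ?E3 p D)"
        using AE_obs_unit
      proof eventually_elim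
        fix \<omega>
        assume unit: "\<forall>j\<ge>1. U j \<omega> \<in> {0<..<1}"
        show "\<omega> \<in> {\<omega>\<in>space M. C * \<bar>real D powr (-1/2)\<bar> < \<bar>proxy c D (\<lambda>j. U j \<omega>) - v0\<bar>}
          \<longrightarrow> \<omega> \<in> ?E1 D \<union> ?E2 D \<union> (\<Union>p\<in>P. ?E3 p D)"
        proof (rule impI, rule ccontr)
          assume bad: "\<omega> \<in> {\<omega>\<in>space M. C * \<bar>real D powr (-1/2)\<bar> < \<bar>proxy c D (\<lambda>j. U j \<omega>) - v0\<bar>}"
            and "\<omega> \<notin> ?E1 D \<union> ?E2 D \<union> (\<Union>p\<in>P. ?E3 p D)"
          then have good: "\<bar>\<Sum>j=1..D. score0 j (U j \<omega>)\<bar> \<le> K * sqrt (real D)"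
              "(\<Sum>j=1..D. H j (U j \<omega>)) \<le> B * real D"
              "\<forall>p\<in>P. \<bar>avg_nll c D (\<lambda>j. U j \<omega>) p - L p\<bar> \<le> d"
            by (auto simp: not_less simp del: One_nat_def)
          have "\<forall>j\<ge>1. \<forall>v\<in>{0<..<1}. \<bar>(deriv ^^ 3) (\<lambda>v. ln (c j (U j \<omega>) v)) v\<bar> \<le> H j (U j \<omega>)"
            using H unit by blast
          from bound[THEN spec[of _ "\<lambda>j. U j \<omega>"], THEN spec[of _ "\<lambda>j. H j (U j \<omega>)"], THEN mp, THEN mp, THEN mp, THEN mp,
              THEN mp, OF unit this good(2,1,3)]
          have "\<bar>proxy c D (\<lambda>j. U j \<omega>) - v0\<bar> \<le> C / sqrt (real D)" .
          also have "\<dots> = C * \<bar>real D powr (-1/2)\<bar>"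
            using D by (simp add: powr_minus_divide powr_half_sqrt)
          finally show False using bad by simp
        qed
      qed
    qed
    also have "\<dots> \<le> prob (?E1 D) + prob (?E2 D) + prob (\<Union>p\<in>P. ?E3 p D)"
      using meas P(1)
      by (intro order_trans[OF measure_Un_le] add_mono order_refl measure_Un_le) auto
    also have "prob (\<Union>p\<in>P. ?E3 p D) \<le> (\<Sum>p\<in>P. prob (?E3 p D))"
      by (rule measure_UNION_le[OF P(1) meas(3)])
    also have "prob (?E1 D) + prob (?E2 D) + (\<Sum>p\<in>P. prob (?E3 p D)) < e"
      using E1 E3 H_tight[THEN spec, THEN mp, OF D] by argo
    finally show "prob {\<omega>\<in>space M. C * \<bar>real D powr (-1/2)\<bar> < \<bar>proxy c D (\<lambda>j. U j \<omega>) - v0\<bar>} < e"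
      by simp
  qed
  then show "\<exists>K>0. \<forall>\<^sub>F D in sequentially. prob {\<omega>\<in>space M. K * \<bar>real D powr (-1/2)\<bar> < \<bar>proxy c D (\<lambda>j. U j \<omega>) - v0\<bar>} < e"
    using P(4) by blast
qed

end

theorem theorem5:
  fixes M :: "'a measure"
    and U :: "nat \<Rightarrow> 'a \<Rightarrow> real"
    and c :: "nat \<Rightarrow> real \<Rightarrow> real \<Rightarrow> real"
    and v0 vmin :: real
    and Lbar :: "real \<Rightarrow> real"
  assumes linking: "\<And>j. 1 \<le> j \<Longrightarrow> copula_density (c j)"
    and latent: "v0 \<in> {0<..<1}"
    and model: "observed_given_latent M c v0 U"
    and monotonic: "\<And>j. 1 \<le> j \<Longrightarrow> monotonic_dependence (c j)"
    and regular: "ml_regular c v0"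
    and limit: "\<And>v. v \<in> {0<..<1} \<Longrightarrow>
        tendsto_in_prob M (\<lambda>D \<omega>. avg_nll c D (\<lambda>j. U j \<omega>) v) (Lbar v)"
    and minimum: "global_min_at Lbar vmin"
    and convex: "strictly_locally_convex_at Lbar vmin"
  shows "bigo_in_prob M (\<lambda>D \<omega>. proxy c D (\<lambda>j. U j \<omega>) - v0) (\<lambda>D. real D powr (-1/2))"
proof -
  interpret regular_factor_model M U c v0
    by unfold_locales (fact linking latent model regular)+
  have v: "vmin \<in> {0<..<1}" using minimum by (simp add: global_min_at_def)
  \<comment> \<open>The hypotheses do not tie \<open>vmin\<close> to \<open>v0\<close>. Minimality
    at \<open>v0\<close> in the weak sense, together with strictness of the minimum at
    \<open>vmin\<close>, identifies the two.\<close>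
  have "Lbar v0 \<le> Lbar vmin" by (rule limit_nll_minimal_at_latent[OF limit v])
  moreover have "Lbar vmin < Lbar v0" if "vmin \<noteq> v0"
  proof -
    have "0 < \<bar>v0 - vmin\<bar>" using that by simp
    then obtain h where "h > 0" "\<forall>v\<in>{0<..<1}. \<bar>v0 - vmin\<bar> \<le> \<bar>v - vmin\<bar> \<longrightarrow> Lbar vmin + h \<le> Lbar v"
      using minimum unfolding global_min_at_def by blast
    then show ?thesis using latent by force
  qed
  ultimately have "vmin = v0" by force
  then show ?thesis
    using proxy_consistency_rate[OF limit] minimum convex by simp
qed

end
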